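(* Let $\Gamma$ be a finite group and let $\mathrm{Cay}(\Gamma,S)$ be a normal oriented Cayley graph. Then $\mathrm{Cay}(\Gamma,S)$ is HS-integral if and only if $S\in\mathbb E(\Gamma)$.
   Context: Let $\Gamma$ be a finite group with identity $\mathbf 1$ and $S\subseteq\Gamma$ with $\mathbf 1\notin S$. The mixed Cayley graph $G=\mathrm{Cay}(\Gamma,S)$ has vertex set $\Gamma$ and edge set $E=\{(a,b): a,b\in\Gamma,\ ba^{-1}\in S\}$ (ordered pairs). It is normal if $S$ is a union of conjugacy classes of $\Gamma$. A subset $A\subseteq \Gamma$ is skew-symmetric if $a^{-1}\notin A$ for all $a\in A$; $\mathrm{Cay}(\Gamma,S)$ is oriented if $S$ is skew-symmetric. The Hermitian-adjacency matrix of the second kind $\mathcal H(G)=(h_{uv})$ has $h_{uv}=1$ if $(u,v),(v,u)\in E$; $h_{uv}=\frac{1+i\sqrt3}{2}$ if $(u,v)\in E$, $(v,u)\notin E$; $h_{uv}=\frac{1-i\sqrt3}{2}$ if $(u,v)\notin E$, $(v,u)\in E$; and $h_{uv}=0$ otherwise. $G$ is HS-integral if all eigenvalues of $\mathcal H(G)$ are integers. $\Gamma(3)=\{x\in\Gamma: 3\mid \mathrm{ord}(x)\}$. On $\Gamma(3)$ define $x\simeq y$ iff $y=x^k$ for some integer $k$ with $\gcd(k,\mathrm{ord}(x))=1$ and $k\equiv1\pmod 3$; the equivalence class of $x$ is denoted $\langle\!\langle x\rangle\!\rangle$. $\mathbb E(\Gamma)$ is the set of all skew-symmetric subsets of $\Gamma$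 of the form $\langle\!\langle x_1\rangle\!\rangle\cup\cdots\cup\langle\!\langle x_k\rangle\!\rangle$ with $x_1,\dots,x_k\in\Gamma(3)$, the empty union $\emptyset$ being included (so $\mathbb E(\Gamma)=\{\emptyset\}$ if $\Gamma(3)=\emptyset$). *)

theory Defs
  imports
    Complex_Main
    "HOL-Algebra.Multiplicative_Group"
    "HOL-Number_Theory.Cong"
    "Jordan_Normal_Form.Char_Poly"
    "Graph_Theory.Pair_Digraph"
begin

definition cayley_graph :: "('a, 'b) monoid_scheme \<Rightarrow> 'a set \<Rightarrow> 'a pair_pre_digraph" where
  "cayley_graph G S =
     \<lparr> pverts = carrier G,
       parcs = {(a, b). a \<in> carrier G \<and> b \<in> carrier G \<and> b \<otimes>\<^bsub>G\<^esub> inv\<^bsub>G\<^esub> a \<in> S} \<rparr>"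

definition conjugacy_class :: "('a, 'b) monoid_scheme \<Rightarrow> 'a \<Rightarrow> 'a set" where
  "conjugacy_class G x = {g \<otimes>\<^bsub>G\<^esub> x \<otimes>\<^bsub>G\<^esub> inv\<^bsub>G\<^esub> g | g. g \<in> carrier G}"

definition normal_cayley :: "('a, 'b) monoid_scheme \<Rightarrow> 'a set \<Rightarrow> bool" where
  "normal_cayley G S \<longleftrightarrow> (\<exists>X \<subseteq> carrier G. S = (\<Union>x\<in>X. conjugacy_class G x))"

definition skew_symmetric :: "('a, 'b) monoid_scheme \<Rightarrow> 'a set \<Rightarrow> bool" where
  "skew_symmetric G A \<longleftrightarrow> A \<subseteq> carrier G \<and> (\<forall>a\<in>A. inv\<^bsub>G\<^esub> a \<notin> A)"

definition oriented_cayley :: "('a, 'b) monoid_scheme \<Rightarrow> 'a set \<Rightarrow> bool" where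
  "oriented_cayley G S \<longleftrightarrow> skew_symmetric G S"

definition hs_entry :: "'v pair_pre_digraph \<Rightarrow> 'v \<Rightarrow> 'v \<Rightarrow> complex" where
  "hs_entry D u v =
     (if (u, v) \<in> parcs D \<and> (v, u) \<in> parcs D then 1
      else if (u, v) \<in> parcs D \<and> (v, u) \<notin> parcs D then (1 + \<i> * complex_of_real (sqrt 3)) / 2
      else if (u, v) \<notin> parcs D \<and> (v, u) \<in> parcs D then (1 - \<i> * complex_of_real (sqrt 3)) / 2
      else 0)"

text \<open>The Hermitian-adjacency matrix of the second kind, with rows and columns
  listed in the order \<open>vs\<close> of the vertices.\<close>

definition hs_matrix :: "'v pair_pre_digraph \<Rightarrow> 'v list \<Rightarrow> complex mat" where
  "hs_matrix D vs = mat (length vs) (length vs) (\<lambda>(i, j). hs_entry D (vs ! i) (vs ! j))"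

text \<open>Intended for finite graphs only: every vertex ordering then gives the same
  eigenvalues (the matrices are permutation-similar), and an ordering exists.\<close>

definition HS_integral :: "'v pair_pre_digraph \<Rightarrow> bool" where
  "HS_integral D \<longleftrightarrow>
     (\<forall>vs. distinct vs \<and> set vs = pverts D \<longrightarrow>
        (\<forall>\<mu>. eigenvalue (hs_matrix D vs) \<mu> \<longrightarrow> \<mu> \<in> \<int>))"

definition Gamma3 :: "('a, 'b) monoid_scheme \<Rightarrow> 'a set" where
  "Gamma3 G = {x \<in> carrier G. 3 dvd group.ord G x}"

definition simeq3 :: "('a, 'b) monoid_scheme \<Rightarrow> 'a \<Rightarrow> 'a \<Rightarrow> bool" where
  "simeq3 G x y \<longleftrightarrow>
     (\<exists>k::int. coprime k (int (group.ord G x)) \<and> [k = 1] (mod 3) \<and> y = x [^]\<^bsub>G\<^esub> k)"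

definition class3 :: "('a, 'b) monoid_scheme \<Rightarrow> 'a \<Rightarrow> 'a set" where
  "class3 G x = {y \<in> Gamma3 G. simeq3 G x y}"

definition EE :: "('a, 'b) monoid_scheme \<Rightarrow> 'a set set" where
  "EE G = {A. skew_symmetric G A \<and>
              (\<exists>X. finite X \<and> X \<subseteq> Gamma3 G \<and> A = (\<Union>x\<in>X. class3 G x))}"

end

theory Submission
  imports
    Defs
    "Jordan_Normal_Form.Schur_Decomposition"
    "HOL-Number_Theory.Number_Theory"
begin

text \<open>
  Put \<open>\<epsilon> = (1 + \<i>\<surd>3) / 2\<close> and let \<open>c t = \<epsilon>\<close> for \<open>t \<in> S\<close>, \<open>c t = cnj \<epsilon>\<close> for \<open>t\<^sup>-\<^sup>1 \<in> S\<close>, and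
  \<open>c t = 0\<close> otherwise. The matrix acts on functions on the group as \<open>Z = (\<Sum>t. c t \<tau>\<^sub>t)\<close> with
  \<open>\<tau>\<^sub>t v u = v (t u)\<close>, and normality says that \<open>Z\<close> commutes with all shifts. Membership of \<open>S\<close> in
  \<open>\<bbbE>\<close> amounts to \<open>c (t\<^sup>k) = \<sigma>\<^sub>k (c t)\<close> for all \<open>k\<close> prime to \<open>n = 3 |\<Gamma>|\<close>, where \<open>\<sigma>\<^sub>k\<close> is the identity or
  complex conjugation according to \<open>k\<close> modulo \<open>3\<close>. Traces replace characters.

  If the condition holds and \<open>\<mu>\<close> is an eigenvalue of \<open>Z\<close> with spectral projection \<open>E\<close>, then
  \<open>\<mu> tr E = tr (Z E) = (\<Sum>t. c t tr (\<tau>\<^sub>t E))\<close>. Summed over the powers \<open>t\<^sup>k\<close> with \<open>k\<close> prime to \<open>n\<close>, the terms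
  give the trace of an operator whose eigenvalues are Ramanujan sums. So \<open>\<mu>\<close> is rational, and it is
  an algebraic integer.

  Conversely, if all eigenvalues of \<open>Z\<close> are integers, then so are the traces of \<open>Z\<close> on the
  eigenspaces of \<open>\<tau>\<^sub>t\<close>, whence \<open>|\<Gamma>| c (t\<^sup>k) = (\<Sum>j. b\<^sub>j \<zeta>\<^sup>j\<^sup>k)\<close> with integers \<open>b\<^sub>j\<close> and \<open>\<zeta>\<^sup>n = 1\<close>. Raising
  the case \<open>k = 1\<close> to the power of a large prime \<open>p\<close> gives \<open>c (t\<^sup>p) = \<sigma>\<^sub>p (c t)\<close>, and every residue prime to
  \<open>n\<close> has a representative all of whose prime factors are large.
\<close>

subsection \<open>Traces and spectral projections of operators on function spaces\<close>

text \<open>Vectors are total functions vanishing off \<open>X\<close>, so that equality of vectors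
  is plain equality of functions and operators compose as ordinary functions.\<close>

definition fun_on :: "'a set \<Rightarrow> ('a \<Rightarrow> complex) set" where
  "fun_on X = {v. \<forall>x. x \<notin> X \<longrightarrow> v x = 0}"

definition lin_op :: "'a set \<Rightarrow> (('a \<Rightarrow> complex) \<Rightarrow> 'a \<Rightarrow> complex) \<Rightarrow> bool" where
  "lin_op X T \<longleftrightarrow> (\<forall>v\<in>fun_on X. T v \<in> fun_on X) \<and>
     (\<forall>v\<in>fun_on X. \<forall>w\<in>fun_on X. \<forall>a b. T (\<lambda>x. a * v x + b * w x) = (\<lambda>x. a * T v x + b * T w x))"

definition delta :: "'a \<Rightarrow> 'a \<Rightarrow> complex" where
  "delta y x = (if x = y then 1 else 0)"

definition op_trace :: "'a set \<Rightarrow> (('a \<Rightarrow> complex) \<Rightarrow> 'a \<Rightarrow> complex) \<Rightarrow> complex" where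
  "op_trace X T = (\<Sum>x\<in>X. T (delta x) x)"

definition op_eigenvalue :: "'a set \<Rightarrow> (('a \<Rightarrow> complex) \<Rightarrow> 'a \<Rightarrow> complex) \<Rightarrow> complex \<Rightarrow> bool" where
  "op_eigenvalue X T \<mu> \<longleftrightarrow> (\<exists>v\<in>fun_on X. v \<noteq> (\<lambda>x. 0) \<and> T v = (\<lambda>x. \<mu> * v x))"

section \<open>Linear operators on functions supported in a set\<close>

lemma fun_on_zero [simp]: "(\<lambda>x. 0) \<in> fun_on X"
  by (simp add: fun_on_def)

lemma fun_on_comb [simp]: "v \<in> fun_on X \<Longrightarrow> w \<in> fun_on X \<Longrightarrow> (\<lambda>x. a * v x + b * w x) \<in> fun_on X"
  by (simp add: fun_on_def)

lemma fun_on_sum: "(\<And>i. i \<in> I \<Longrightarrow> f i \<in> fun_on X) \<Longrightarrow> (\<lambda>x. \<Sum>i\<in>I. a i * f i x) \<in> fun_on X"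
  by (simp add: fun_on_def)

lemma delta_fun_on [simp]: "y \<in> X \<Longrightarrow> delta y \<in> fun_on X"
  by (auto simp: fun_on_def delta_def)

lemma lin_op_closed: "lin_op X T \<Longrightarrow> v \<in> fun_on X \<Longrightarrow> T v \<in> fun_on X"
  by (simp add: lin_op_def)

lemma lin_op_comb:
  "lin_op X T \<Longrightarrow> v \<in> fun_on X \<Longrightarrow> w \<in> fun_on X \<Longrightarrow>
     T (\<lambda>x. a * v x + b * w x) = (\<lambda>x. a * T v x + b * T w x)"
  by (simp add: lin_op_def)

lemma lin_op_smult: "lin_op X T \<Longrightarrow> v \<in> fun_on X \<Longrightarrow> T (\<lambda>x. a * v x) = (\<lambda>x. a * T v x)"
  using lin_op_comb[of X T v v a 0] by simp

lemma lin_op_add: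
  "lin_op X T \<Longrightarrow> v \<in> fun_on X \<Longrightarrow> w \<in> fun_on X \<Longrightarrow> T (\<lambda>x. v x + w x) = (\<lambda>x. T v x + T w x)"
  using lin_op_comb[of X T v w 1 1] by simp

lemma lin_op_zero: "lin_op X T \<Longrightarrow> T (\<lambda>x. 0) = (\<lambda>x. 0)"
  using lin_op_smult[of X T "\<lambda>x. 0" 0] by simp

lemma lin_op_sum:
  assumes T: "lin_op X T" and "finite I" and "\<And>i. i \<in> I \<Longrightarrow> f i \<in> fun_on X"
  shows "T (\<lambda>x. \<Sum>i\<in>I. a i * f i x) = (\<lambda>x. \<Sum>i\<in>I. a i * T (f i) x)"
  using assms(2,3)
proof (induction I rule: finite_induct)
  case empty
  then show ?case by (simp add: lin_op_zero[OF T])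
next
  case (insert i I)
  then have "T (\<lambda>x. a i * f i x + 1 * (\<Sum>i\<in>I. a i * f i x))
      = (\<lambda>x. a i * T (f i) x + 1 * T (\<lambda>x. \<Sum>i\<in>I. a i * f i x) x)"
    by (intro lin_op_comb[OF T] fun_on_sum) auto
  then show ?case using insert by simp
qed

lemma fun_on_expand:
  assumes "finite X" "v \<in> fun_on X"
  shows "v = (\<lambda>x. \<Sum>y\<in>X. v y * delta y x)"
proof
  fix x
  show "v x = (\<Sum>y\<in>X. v y * delta y x)"
    using assms by (cases "x \<in> X") (auto simp: delta_def fun_on_def if_distrib cong: if_cong)
qed

lemma lin_op_expand:
  assumes "finite X" "lin_op X T" "v \<in> fun_on X"
  shows "T v = (\<lambda>x. \<Sum>y\<in>X. v y * T (delta y) x)"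
proof -
  have "T v = T (\<lambda>x. \<Sum>y\<in>X. v y * delta y x)"
    using fun_on_expand[OF assms(1,3)] by simp
  also have "\<dots> = (\<lambda>x. \<Sum>y\<in>X. v y * T (delta y) x)"
    by (rule lin_op_sum) (use assms in auto)
  finally show ?thesis .
qed

lemma lin_op_compose:
  assumes "lin_op X T" "lin_op X U"
  shows "lin_op X (\<lambda>v. T (U v))"
  using assms unfolding lin_op_def by simp

lemma lin_op_lincomb:
  assumes "\<And>i. i \<in> I \<Longrightarrow> lin_op X (T i)"
  shows "lin_op X (\<lambda>v x. \<Sum>i\<in>I. a i * T i v x)"
  unfolding lin_op_def
proof (intro conjI ballI allI)
  fix v assume "v \<in> fun_on X"
  then show "(\<lambda>x. \<Sum>i\<in>I. a i * T i v x) \<in> fun_on X"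
    by (intro fun_on_sum) (use assms lin_op_closed in blast)
next
  fix v w b c assume vw: "v \<in> fun_on X" "w \<in> fun_on X"
  have "(\<Sum>i\<in>I. a i * T i (\<lambda>x. b * v x + c * w x) x)
      = (\<Sum>i\<in>I. b * (a i * T i v x) + c * (a i * T i w x))" for x
    by (rule sum.cong) (simp_all add: lin_op_comb[OF assms vw] algebra_simps)
  then show "(\<lambda>x. \<Sum>i\<in>I. a i * T i (\<lambda>x. b * v x + c * w x) x)
      = (\<lambda>x. b * (\<Sum>i\<in>I. a i * T i v x) + c * (\<Sum>i\<in>I. a i * T i w x))"
    by (simp add: sum.distrib sum_distrib_left)
qed

section \<open>Traces as sums of eigenvalues\<close>

lemma trace_mult_commute:
  fixes A B :: "complex mat"
  assumes "A \<in> carrier_mat n n" "B \<in> carrier_mat n n"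
  shows "(\<Sum>i<n. (A * B) $$ (i, i)) = (\<Sum>i<n. (B * A) $$ (i, i))"
proof -
  have "(\<Sum>i<n. (A * B) $$ (i, i)) = (\<Sum>i<n. \<Sum>j<n. A $$ (i, j) * B $$ (j, i))"
    using assms by (intro sum.cong) (auto simp: scalar_prod_def atLeast0LessThan)
  also have "\<dots> = (\<Sum>j<n. \<Sum>i<n. B $$ (j, i) * A $$ (i, j))"
    by (subst sum.swap) (simp add: mult.commute)
  also have "\<dots> = (\<Sum>i<n. (B * A) $$ (i, i))"
    using assms by (intro sum.cong) (auto simp: scalar_prod_def atLeast0LessThan)
  finally show ?thesis .
qed

text \<open>Schur triangularisation: the trace is invariant under similarity, and the diagonal of
  the triangular matrix lists the roots of the characteristic polynomial. The list \<open>es\<close>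
  carries the multiplicities for the sum; only its set of members is tied to the
  eigenvalues.\<close>

lemma mat_trace_eq_sum_eigenvalues:
  fixes M :: "complex mat"
  assumes M: "M \<in> carrier_mat n n"
  obtains es where "(\<Sum>i<n. M $$ (i, i)) = sum_list es" "set es = {\<mu>. eigenvalue M \<mu>}"
proof -
  obtain as where as: "char_poly M = (\<Prod>a\<leftarrow>as. [:- a, 1:])"
    using char_poly_factorized[OF M] by blast
  obtain B where B: "B \<in> carrier_mat n n" "upper_triangular B" "similar_mat M B"
    using schur_decomposition_exists[OF M as] by blast
  obtain P Q where PQ: "similar_mat_wit M B P Q"
    using B(3) unfolding similar_mat_def by blast
  note W = similar_mat_witD2[OF M PQ]
  have "(\<Sum>i<n. M $$ (i, i)) = (\<Sum>i<n. (P * B * Q) $$ (i, i))"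
    using W by simp
  also have "\<dots> = (\<Sum>i<n. (Q * (P * B)) $$ (i, i))"
    by (rule trace_mult_commute) (use W in auto)
  also have "Q * (P * B) = B"
    using W by (metis assoc_mult_mat left_mult_one_mat)
  also have "(\<Sum>i<n. B $$ (i, i)) = sum_list (diag_mat B)"
    using B(1) by (simp add: diag_mat_def interv_sum_list_conv_sum_set_nat atLeast0LessThan)
  finally have tr: "(\<Sum>i<n. M $$ (i, i)) = sum_list (diag_mat B)" .
  have cp: "char_poly M = (\<Prod>a\<leftarrow>diag_mat B. [:- a, 1:])"
    using char_poly_similar[OF B(3)] char_poly_upper_triangular[OF B(1,2)] by simp
  have "set (diag_mat B) = {\<mu>. eigenvalue M \<mu>}"
    using eigenvalue_root_char_poly[OF M] unfolding cp
    by (auto simp: poly_prod_list prod_list_zero_iff)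
  with tr show ?thesis by (rule that)
qed

text \<open>The matrix is that of \<open>T\<close> in the basis of delta functions ordered by
  \<open>xs\<close>. Eigenvectors pass from one side to the other by reading off values along
  \<open>xs\<close> and by extending by zero.\<close>

lemma enum_eigenvalue:
  assumes xs: "distinct xs" "set xs = X" and T: "lin_op X T"
  shows "eigenvalue (mat (length xs) (length xs) (\<lambda>(i, j). T (delta (xs ! j)) (xs ! i))) \<mu>
     \<longleftrightarrow> op_eigenvalue X T \<mu>"
    (is "eigenvalue ?M \<mu> \<longleftrightarrow> _")
proof -
  let ?n = "length xs"
  have fin: "finite X" using xs by auto
  have reindex: "(\<Sum>y\<in>X. g y) = (\<Sum>j<?n. g (xs ! j))" for g :: "'a \<Rightarrow> complex"
    using sum.reindex_bij_betw[OF bij_betw_nth[OF xs(1) refl xs(2)[symmetric]], of g] by simp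
  have app: "(?M *\<^sub>v vec ?n (\<lambda>i. v (xs ! i))) $ i = T v (xs ! i)"
    if "i < ?n" "v \<in> fun_on X" for i v
    by (subst lin_op_expand[OF fin T that(2)], subst reindex)
       (use that(1) in \<open>simp add: scalar_prod_def atLeast0LessThan mult.commute\<close>)
  show ?thesis
  proof
    assume "eigenvalue ?M \<mu>"
    then obtain u where u: "u \<in> carrier_vec ?n" "u \<noteq> 0\<^sub>v ?n" "?M *\<^sub>v u = \<mu> \<cdot>\<^sub>v u"
      unfolding eigenvalue_def eigenvector_def by auto
    define v where "v x = (\<Sum>i<?n. u $ i * delta (xs ! i) x)" for x
    have v: "v \<in> fun_on X"
      unfolding v_def by (intro fun_on_sum) (use xs in auto)
    have vi: "v (xs ! i) = u $ i" if "i < ?n" for i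
      using that xs(1) by (simp add: v_def delta_def nth_eq_iff_index_eq if_distrib cong: if_cong)
    have u_eq: "u = vec ?n (\<lambda>i. v (xs ! i))"
      using u(1) vi by auto
    have "v \<noteq> (\<lambda>x. 0)"
    proof
      assume "v = (\<lambda>x. 0)"
      then have "u = 0\<^sub>v ?n" using u_eq by auto
      with u(2) show False by simp
    qed
    moreover have "T v x = \<mu> * v x" for x
    proof (cases "x \<in> X")
      case True
      then obtain i where i: "i < ?n" "x = xs ! i"
        using xs by (metis in_set_conv_nth)
      have "T v x = (?M *\<^sub>v u) $ i"
        using app[OF i(1) v] u_eq i(2) by simp
      then show ?thesis using u(1,3) i vi by simp
    next
      case False
      then show ?thesis using lin_op_closed[OF T v] v by (simp add: fun_on_def)
    qed
    ultimately show "op_eigenvalue X T \<mu>"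
      using v unfolding op_eigenvalue_def by blast
  next
    assume "op_eigenvalue X T \<mu>"
    then obtain v where v: "v \<in> fun_on X" "v \<noteq> (\<lambda>x. 0)" "T v = (\<lambda>x. \<mu> * v x)"
      unfolding op_eigenvalue_def by blast
    let ?u = "vec ?n (\<lambda>i. v (xs ! i))"
    obtain x where "v x \<noteq> 0" using v(2) by auto
    moreover from this obtain i where "i < ?n" "x = xs ! i"
      using v(1) xs unfolding fun_on_def by (metis (mono_tags, lifting) in_set_conv_nth mem_Collect_eq)
    ultimately have "?u \<noteq> 0\<^sub>v ?n"
      by (metis index_vec index_zero_vec(1))
    moreover have "?M *\<^sub>v ?u = \<mu> \<cdot>\<^sub>v ?u"
    proof (rule eq_vecI)
      fix i assume "i < dim_vec (\<mu> \<cdot>\<^sub>v ?u)"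
      then have "i < ?n" by simp
      then show "(?M *\<^sub>v ?u) $ i = (\<mu> \<cdot>\<^sub>v ?u) $ i"
        using app[OF _ v(1)] v(3) by simp
    qed simp
    ultimately show "eigenvalue ?M \<mu>"
      unfolding eigenvalue_def eigenvector_def by (intro exI[of _ ?u]) simp
  qed
qed

lemma op_trace_eq_sum_eigenvalues:
  assumes "finite X" "lin_op X T"
  obtains es where "op_trace X T = sum_list es" "set es = {\<mu>. op_eigenvalue X T \<mu>}"
proof -
  obtain xs where xs: "distinct xs" "set xs = X"
    using finite_distinct_list[OF assms(1)] by blast
  let ?n = "length xs"
  let ?M = "mat ?n ?n (\<lambda>(i, j). T (delta (xs ! j)) (xs ! i))"
  obtain es where es: "(\<Sum>i<?n. ?M $$ (i, i)) = sum_list es" "set es = {\<mu>. eigenvalue ?M \<mu>}"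
    by (rule mat_trace_eq_sum_eigenvalues[of ?M ?n]) auto
  have "op_trace X T = (\<Sum>i<?n. T (delta (xs ! i)) (xs ! i))"
    unfolding op_trace_def
    using sum.reindex_bij_betw[OF bij_betw_nth[OF xs(1) refl xs(2)[symmetric]], of "\<lambda>x. T (delta x) x"]
    by simp
  also have "\<dots> = sum_list es"
    using es(1) by simp
  finally show ?thesis
    using that es(2) enum_eigenvalue[OF xs assms(2)] by simp
qed

lemma op_trace_Ints:
  assumes "finite X" "lin_op X T" "\<And>\<mu>. op_eigenvalue X T \<mu> \<Longrightarrow> \<mu> \<in> \<int>"
  shows "op_trace X T \<in> \<int>"
proof -
  obtain es where "op_trace X T = sum_list es" "set es = {\<mu>. op_eigenvalue X T \<mu>}"
    using op_trace_eq_sum_eigenvalues[OF assms(1,2)] .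
  moreover have "set es \<subseteq> \<int> \<Longrightarrow> sum_list es \<in> \<int>"
    by (induction es) auto
  ultimately show ?thesis using assms(3) by auto
qed

lemma op_trace_lincomb:
  "op_trace X (\<lambda>v x. \<Sum>i\<in>I. a i * T i v x) = (\<Sum>i\<in>I. a i * op_trace X (T i))"
  unfolding op_trace_def sum_distrib_left by (rule sum.swap)

section \<open>Polynomials in an operator\<close>

lemma bezout_linear_power:
  fixes q :: "'b :: field poly"
  assumes "poly q \<mu> \<noteq> 0"
  shows "\<exists>a b. a * [:- \<mu>, 1:] ^ m + b * q = 1"
proof -
  define c where "c = [:inverse (poly q \<mu>):]"
  have "poly (1 - c * q) \<mu> = 0"
    using assms by (simp add: c_def)
  then obtain s where s: "1 - c * q = [:- \<mu>, 1:] * s"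
    unfolding poly_eq_0_iff_dvd by (elim dvdE)
  \<comment> \<open>The constant \<open>c\<close> gives \<open>c * q\<close> the value 1 at
    \<open>\<mu>\<close>, so \<open>(1 - c * q) ^ m\<close> is a multiple of the \<open>m\<close>th
    power of the linear factor, while its difference from 1 is a multiple of
    \<open>q\<close>.\<close>
  have "1 - (1 - c * q) ^ m = (c * q) * (\<Sum>i<m. (1 - c * q) ^ i)"
    using one_diff_power_eq[of "1 - c * q" m] by simp
  then have "s ^ m * [:- \<mu>, 1:] ^ m + (c * (\<Sum>i<m. (1 - c * q) ^ i)) * q = 1"
    unfolding s power_mult_distrib by (simp add: algebra_simps)
  then show ?thesis by blast
qed

text \<open>The vector p(T) v, evaluated by Horner's scheme.\<close>

definition poly_op :: "(('a \<Rightarrow> complex) \<Rightarrow> 'a \<Rightarrow> complex) \<Rightarrow> complex poly \<Rightarrow> ('a \<Rightarrow> complex) \<Rightarrow> 'a \<Rightarrow> complex" where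
  "poly_op T p v = fold_coeffs (\<lambda>a w x. a * v x + T w x) p (\<lambda>x. 0)"

lemma poly_op_0 [simp]: "poly_op T 0 v = (\<lambda>x. 0)"
  by (simp add: poly_op_def)

context
  fixes X :: "'a set" and T :: "('a \<Rightarrow> complex) \<Rightarrow> 'a \<Rightarrow> complex"
  assumes T: "lin_op X T"
begin

lemma poly_op_pCons: "poly_op T (pCons a p) v = (\<lambda>x. a * v x + T (poly_op T p v) x)"
proof (cases "p = 0 \<and> a = 0")
  case True
  then show ?thesis by (simp add: lin_op_zero[OF T])
next
  case False
  then show ?thesis
    by (cases "a = 0")
      (auto simp: poly_op_def fold_coeffs_pCons_coeff_not_0_eq fold_coeffs_pCons_not_0_0_eq)
qed

lemma poly_op_closed [simp]: "v \<in> fun_on X \<Longrightarrow> poly_op T p v \<in> fun_on X"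
  by (induction p) (simp_all add: poly_op_pCons lin_op_closed[OF T] fun_on_comb[of _ X _ _ 1, simplified])

lemma lin_op_poly_op: "lin_op X (poly_op T p)"
proof (induction p)
  case 0
  then show ?case by (simp add: lin_op_def)
next
  case (pCons a p)
  show ?case
    unfolding lin_op_def
  proof (intro conjI ballI allI)
    fix v assume "v \<in> fun_on X"
    then show "poly_op T (pCons a p) v \<in> fun_on X" by simp
  next
    fix v w b c assume vw: "v \<in> fun_on X" "w \<in> fun_on X"
    show "poly_op T (pCons a p) (\<lambda>x. b * v x + c * w x)
        = (\<lambda>x. b * poly_op T (pCons a p) v x + c * poly_op T (pCons a p) w x)"
      by (simp add: poly_op_pCons lin_op_comb[OF pCons(2) vw] lin_op_comb[OF T] vw algebra_simps)
  qed
qed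

lemma poly_op_add:
  assumes v: "v \<in> fun_on X"
  shows "poly_op T (p + q) v = (\<lambda>x. poly_op T p v x + poly_op T q v x)"
proof (induction p q rule: poly_induct2)
  case (pCons a p b q)
  then show ?case
    by (simp add: poly_op_pCons lin_op_add[OF T] v algebra_simps)
qed simp

lemma poly_op_smult:
  assumes v: "v \<in> fun_on X"
  shows "poly_op T (Polynomial.smult a p) v = (\<lambda>x. a * poly_op T p v x)"
  by (induction p) (simp_all add: poly_op_pCons lin_op_smult[OF T] v algebra_simps)

lemma poly_op_mult:
  assumes v: "v \<in> fun_on X"
  shows "poly_op T (p * q) v = poly_op T p (poly_op T q v)"
  by (induction p) (simp_all add: poly_op_pCons poly_op_add poly_op_smult v)

lemma poly_op_commute:
  assumes U: "lin_op X U" and comm: "\<And>v. v \<in> fun_on X \<Longrightarrow> U (T v) = T (U v)" and v: "v \<in> fun_on X"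
  shows "U (poly_op T p v) = poly_op T p (U v)"
proof (induction p)
  case 0
  then show ?case by (simp add: lin_op_zero[OF U])
next
  case (pCons a p)
  have "U (\<lambda>x. a * v x + 1 * T (poly_op T p v) x) = (\<lambda>x. a * U v x + 1 * U (T (poly_op T p v)) x)"
    by (rule lin_op_comb[OF U]) (simp_all add: v lin_op_closed[OF T])
  then show ?case
    by (simp add: poly_op_pCons comm v pCons)
qed

lemma poly_op_eigenvector:
  assumes v: "v \<in> fun_on X" and ev: "T v = (\<lambda>x. \<mu> * v x)"
  shows "poly_op T p v = (\<lambda>x. poly p \<mu> * v x)"
  by (induction p) (simp_all add: poly_op_pCons lin_op_smult[OF T] v ev ring_distribs mult.assoc mult.left_commute)

lemma poly_op_sum:
  assumes v: "v \<in> fun_on X" and "finite I"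
  shows "poly_op T (\<Sum>i\<in>I. p i) v = (\<lambda>x. \<Sum>i\<in>I. poly_op T (p i) v x)"
  using assms(2) by (induction I rule: finite_induct) (simp_all add: poly_op_add v)

text \<open>In dimension n the n + 1 vectors v, T v, ..., T^n v are dependent. Their coordinates
  form the columns of a matrix made square by a zero row; its determinant vanishes, and a kernel
  vector supplies the coefficients of \<open>f\<close>.\<close>

lemma poly_op_annihilates_vector:
  assumes "finite X" and v: "v \<in> fun_on X"
  obtains f where "f \<noteq> 0" "poly_op T f v = (\<lambda>x. 0)"
proof -
  obtain xs where xs: "distinct xs" "set xs = X"
    using finite_distinct_list[OF assms(1)] by blast
  let ?n = "length xs"
  let ?N = "mat (Suc ?n) (Suc ?n)
    (\<lambda>(i, j). if i < ?n then poly_op T (Polynomial.monom 1 j) v (xs ! i) else 0)"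
  have "det ?N = 0"
    using laplace_expansion_row[of ?N "Suc ?n" ?n] by simp
  then obtain c where c: "c \<in> carrier_vec (Suc ?n)" "c \<noteq> 0\<^sub>v (Suc ?n)" "?N *\<^sub>v c = 0\<^sub>v (Suc ?n)"
    using det_0_iff_vec_prod_zero_field[of ?N "Suc ?n"] by auto
  define f where "f = (\<Sum>j<Suc ?n. Polynomial.smult (c $ j) (Polynomial.monom 1 j))"
  have coeff: "coeff f j = c $ j" if "j < Suc ?n" for j
    using that by (simp add: f_def coeff_sum if_distrib cong: if_cong del: sum.lessThan_Suc)
  have "f \<noteq> 0"
  proof
    assume "f = 0"
    then have "c = 0\<^sub>v (Suc ?n)"
      using c(1) coeff by (intro eq_vecI) auto
    with c(2) show False by simp
  qed
  moreover have "poly_op T f v x = 0" for x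
  proof (cases "x \<in> X")
    case True
    then obtain i where i: "i < ?n" "x = xs ! i"
      using xs by (metis in_set_conv_nth)
    have "poly_op T f v x = (\<Sum>j<Suc ?n. c $ j * poly_op T (Polynomial.monom 1 j) v x)"
      by (simp add: f_def poly_op_sum v poly_op_smult poly_op_add del: sum.lessThan_Suc)
    also have "\<dots> = (?N *\<^sub>v c) $ i"
      using i c(1) by (simp add: scalar_prod_def atLeast0LessThan mult.commute del: sum.lessThan_Suc)
    also have "\<dots> = 0"
      using c(3) i(1) by simp
    finally show ?thesis .
  next
    case False
    then show ?thesis using poly_op_closed[OF v, of f] by (simp add: fun_on_def)
  qed
  ultimately show ?thesis using that by auto
qed

text \<open>Multiply the annihilators of all basis vectors: the factor belonging to a given basis
  vector can be applied first.\<close>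

lemma poly_op_annihilates:
  assumes "finite X"
  obtains f where "f \<noteq> 0" "\<And>v. v \<in> fun_on X \<Longrightarrow> poly_op T f v = (\<lambda>x. 0)"
proof -
  have "\<forall>y\<in>X. \<exists>f. f \<noteq> 0 \<and> poly_op T f (delta y) = (\<lambda>x. 0)"
    using poly_op_annihilates_vector[OF assms delta_fun_on] by metis
  then obtain F where F: "\<And>y. y \<in> X \<Longrightarrow> F y \<noteq> 0 \<and> poly_op T (F y) (delta y) = (\<lambda>x. 0)"
    by metis
  have "poly_op T (\<Prod>y\<in>X. F y) v = (\<lambda>x. 0)" if v: "v \<in> fun_on X" for v
  proof -
    have "poly_op T (\<Prod>y\<in>X. F y) (delta y) = (\<lambda>x. 0)" if "y \<in> X" for y
    proof -
      have "(\<Prod>y\<in>X. F y) = (\<Prod>y\<in>X - {y}. F y) * F y"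
        using prod.remove[OF assms that, of F] by (simp add: mult.commute)
      then show ?thesis
        by (simp add: poly_op_mult that F lin_op_zero[OF lin_op_poly_op])
    qed
    then show ?thesis
      using lin_op_expand[OF assms lin_op_poly_op v, of "\<Prod>y\<in>X. F y"] by simp
  qed
  moreover have "(\<Prod>y\<in>X. F y) \<noteq> 0"
    using F assms by (simp add: prod_zero_iff)
  ultimately show ?thesis using that by blast
qed

text \<open>Writing an annihilating polynomial of \<open>T\<close> as \<open>(x - \<mu>)\<^sup>m q\<close> with \<open>q(\<mu>) \<noteq> 0\<close>, a Bezout
  identity \<open>a (x - \<mu>)\<^sup>m + b q = 1\<close> makes \<open>b q\<close> evaluated at \<open>T\<close> the projection onto the
  generalised eigenspace.\<close>

lemma spectral_projection:
  assumes "finite X" and "op_eigenvalue X T \<mu>"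
  obtains p m where
    "\<And>v. v \<in> fun_on X \<Longrightarrow> poly_op T p (poly_op T p v) = poly_op T p v"
    "\<And>v. v \<in> fun_on X \<Longrightarrow> poly_op T ([:- \<mu>, 1:] ^ m) (poly_op T p v) = (\<lambda>x. 0)"
    "poly p \<mu> = 1" "m > 0"
proof -
  obtain f where f: "f \<noteq> 0" "\<And>v. v \<in> fun_on X \<Longrightarrow> poly_op T f v = (\<lambda>x. 0)"
    using poly_op_annihilates[OF assms(1)] by blast
  obtain w where w: "w \<in> fun_on X" "w \<noteq> (\<lambda>x. 0)" "T w = (\<lambda>x. \<mu> * w x)"
    using assms(2) unfolding op_eigenvalue_def by blast
  have "poly f \<mu> = 0"
  proof -
    have "(\<lambda>x. poly f \<mu> * w x) = (\<lambda>x. 0)"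
      using poly_op_eigenvector[OF w(1,3), of f] f(2)[OF w(1)] by simp
    then show ?thesis using w(2) by (auto simp: fun_eq_iff)
  qed
  define m where "m = order \<mu> f"
  obtain q where q: "f = [:- \<mu>, 1:] ^ m * q" "\<not> [:- \<mu>, 1:] dvd q"
    using order_decomp[OF f(1), of \<mu>] unfolding m_def by blast
  have m: "m > 0"
    using \<open>poly f \<mu> = 0\<close> f(1) by (simp add: m_def order_root)
  have "poly q \<mu> \<noteq> 0"
    using q(2) by (simp add: poly_eq_0_iff_dvd)
  then obtain a b where ab: "a * [:- \<mu>, 1:] ^ m + b * q = 1"
    using bezout_linear_power by blast
  define p where "p = b * q"
  have kill: "poly_op T (r * f) v = (\<lambda>x. 0)" if "v \<in> fun_on X" for r v
    by (simp add: poly_op_mult that f(2) lin_op_zero[OF lin_op_poly_op])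
  \<comment> \<open>By the Bezout identity \<open>1 - p\<close> is a multiple of the power of the
    linear factor, so \<open>p * (1 - p)\<close> is a multiple of \<open>f\<close>: \<open>p\<close>
    is idempotent modulo \<open>f\<close>.\<close>
  have "p * p = p + (- a * b) * f"
  proof -
    have "p * (a * [:- \<mu>, 1:] ^ m + p) = p" using ab unfolding p_def by simp
    then have "p * p = p - p * a * [:- \<mu>, 1:] ^ m" by (simp add: algebra_simps)
    then show ?thesis unfolding p_def q(1) by (simp add: algebra_simps)
  qed
  then have "poly_op T p (poly_op T p v) = poly_op T p v" if "v \<in> fun_on X" for v
    using poly_op_mult[OF that, of p p] poly_op_add[OF that, of p "(- a * b) * f"] kill[OF that, of "- a * b"]
    by simp
  moreover have "poly_op T ([:- \<mu>, 1:] ^ m) (poly_op T p v) = (\<lambda>x. 0)" if "v \<in> fun_on X" for v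
  proof -
    have "[:- \<mu>, 1:] ^ m * p = b * f" unfolding p_def q(1) by (simp add: algebra_simps)
    then show ?thesis using kill[OF that, of b] poly_op_mult[OF that, of "[:- \<mu>, 1:] ^ m" p] by simp
  qed
  moreover have "poly p \<mu> = 1"
  proof -
    have "poly (a * [:- \<mu>, 1:] ^ m + b * q) \<mu> = 1" by (simp only: ab poly_1)
    then show ?thesis using m by (simp add: p_def zero_power)
  qed
  ultimately show ?thesis using that m by blast
qed

end

text \<open>The vector \<open>U (E v)\<close> is fixed by \<open>E\<close>, hence so is
  \<open>\<mu>\<close> times \<open>v\<close>. A nonzero \<open>\<mu>\<close> therefore puts
  \<open>v\<close> in the range of \<open>E\<close>, where the composition is just
  \<open>U\<close>.\<close>

lemma op_eigenvalue_compose_idempotent: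
  assumes U: "lin_op X U" and E: "lin_op X E"
    and idem: "\<And>v. v \<in> fun_on X \<Longrightarrow> E (E v) = E v"
    and comm: "\<And>v. v \<in> fun_on X \<Longrightarrow> U (E v) = E (U v)"
    and ev: "op_eigenvalue X (\<lambda>v. U (E v)) \<mu>" and "\<mu> \<noteq> 0"
  obtains v where "v \<in> fun_on X" "v \<noteq> (\<lambda>x. 0)" "E v = v" "U v = (\<lambda>x. \<mu> * v x)"
proof -
  obtain v where v: "v \<in> fun_on X" "v \<noteq> (\<lambda>x. 0)" "U (E v) = (\<lambda>x. \<mu> * v x)"
    using ev unfolding op_eigenvalue_def by blast
  have "(\<lambda>x. \<mu> * E v x) = E (U (E v))"
    by (simp add: v(3) lin_op_smult[OF E v(1)])
  also have "\<dots> = U (E v)"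
    using comm idem lin_op_closed[OF E] v(1) by metis
  finally have "E v = v"
    using v(3) \<open>\<mu> \<noteq> 0\<close> by (simp add: fun_eq_iff)
  then show ?thesis using that v by metis
qed

text \<open>The projection has eigenvalues in {0, 1} and 1 does occur, so its trace is a nonzero
  integer. The operator (T - \<mu>) E has no eigenvalue but 0, so its trace vanishes, which gives
  the last equation.\<close>

lemma spectral_projection_trace:
  assumes T: "lin_op X T" and fin: "finite X" and ev: "op_eigenvalue X T \<mu>"
  obtains E where "lin_op X E" "\<And>v. v \<in> fun_on X \<Longrightarrow> E (E v) = E v"
    "\<And>U v. lin_op X U \<Longrightarrow> (\<And>v. v \<in> fun_on X \<Longrightarrow> U (T v) = T (U v)) \<Longrightarrow> v \<in> fun_on X \<Longrightarrow> U (E v) = E (U v)"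
    "op_trace X E \<in> \<int>" "op_trace X E \<noteq> 0" "op_trace X (\<lambda>v. T (E v)) = \<mu> * op_trace X E"
proof -
  obtain p m where p: "\<And>v. v \<in> fun_on X \<Longrightarrow> poly_op T p (poly_op T p v) = poly_op T p v"
    and kill: "\<And>v. v \<in> fun_on X \<Longrightarrow> poly_op T ([:- \<mu>, 1:] ^ m) (poly_op T p v) = (\<lambda>x. 0)"
    and p1: "poly p \<mu> = 1" and m: "m > 0"
    using spectral_projection[OF T fin ev] by blast
  let ?E = "poly_op T p"
  have E: "lin_op X ?E" by (rule lin_op_poly_op[OF T])
  obtain es where es: "op_trace X ?E = sum_list es" "set es = {\<mu>. op_eigenvalue X ?E \<mu>}"
    using op_trace_eq_sum_eigenvalues[OF fin E] .
  have "\<nu> = 0 \<or> \<nu> = 1" if ev': "op_eigenvalue X ?E \<nu>" for \<nu>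
  proof -
    obtain v where v: "v \<in> fun_on X" "v \<noteq> (\<lambda>x. 0)" "?E v = (\<lambda>x. \<nu> * v x)"
      using ev' unfolding op_eigenvalue_def by blast
    have "(\<lambda>x. \<nu> * v x) = (\<lambda>x. \<nu> * (\<nu> * v x))"
      using p[OF v(1)] lin_op_smult[OF E v(1), of \<nu>] v(3) by simp
    then show ?thesis using v(2) by (auto simp: fun_eq_iff)
  qed
  then have 01: "set es \<subseteq> {0, 1}" using es(2) by auto
  have "1 \<in> set es"
  proof -
    obtain w where w: "w \<in> fun_on X" "w \<noteq> (\<lambda>x. 0)" "T w = (\<lambda>x. \<mu> * w x)"
      using ev unfolding op_eigenvalue_def by blast
    have "?E w = (\<lambda>x. 1 * w x)"
      using poly_op_eigenvector[OF T w(1,3)] p1 by simp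
    then show ?thesis using w es(2) unfolding op_eigenvalue_def by blast
  qed
  moreover have "sum_list es = of_nat (count_list es 1)"
    using 01 by (induction es) auto
  ultimately have tr: "op_trace X ?E \<in> \<int>" "op_trace X ?E \<noteq> 0"
    using es(1) by (auto simp: count_list_0_iff)
  let ?U = "poly_op T [:- \<mu>, 1:]"
  have U: "lin_op X ?U" by (rule lin_op_poly_op[OF T])
  have Ueq: "?U v = (\<lambda>x. T v x - \<mu> * v x)" for v
    by (simp add: poly_op_pCons[OF T] lin_op_zero[OF T])
  have "\<nu> = 0" if ev': "op_eigenvalue X (\<lambda>v. ?U (?E v)) \<nu>" for \<nu>
  proof (rule ccontr)
    assume "\<nu> \<noteq> 0"
    have comm: "?U (?E v) = ?E (?U v)" if "v \<in> fun_on X" for v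
      using poly_op_mult[OF T that, of p "[:- \<mu>, 1:]"] poly_op_mult[OF T that, of "[:- \<mu>, 1:]" p]
      by (simp only: mult.commute)
    obtain v where v: "v \<in> fun_on X" "v \<noteq> (\<lambda>x. 0)" "?E v = v" "?U v = (\<lambda>x. \<nu> * v x)"
      using op_eigenvalue_compose_idempotent[OF U E p comm ev' \<open>\<nu> \<noteq> 0\<close>] .
    have "T v = (\<lambda>x. (\<mu> + \<nu>) * v x)"
      using v(4) unfolding Ueq by (simp add: fun_eq_iff algebra_simps)
    \<comment> \<open>At \<open>\<mu> + \<nu>\<close> the annihilating power takes the value
      \<open>\<nu> ^ m\<close>, which must then kill \<open>v\<close>.\<close>
    from poly_op_eigenvector[OF T v(1) this, of "[:- \<mu>, 1:] ^ m"]
    have "(\<lambda>x. 0) = (\<lambda>x. \<nu> ^ m * v x)"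
      using kill[OF v(1)] v(3) by simp
    then show False using v(2) \<open>\<nu> \<noteq> 0\<close> by (auto simp: fun_eq_iff)
  qed
  moreover obtain es' where es': "op_trace X (\<lambda>v. ?U (?E v)) = sum_list es'"
    "set es' = {\<nu>. op_eigenvalue X (\<lambda>v. ?U (?E v)) \<nu>}"
    using op_trace_eq_sum_eigenvalues[OF fin lin_op_compose[OF U E]] .
  ultimately have "set es' \<subseteq> {0}" by auto
  then have "sum_list es' = 0" by (induction es') auto
  then have "op_trace X (\<lambda>v. T (?E v)) = \<mu> * op_trace X ?E"
    using es'(1) unfolding op_trace_def Ueq by (simp add: sum_subtractf sum_distrib_left)
  then show ?thesis
    using that[OF E p poly_op_commute[OF T] tr] by blast
qed

text \<open>Split linear factors off \<open>f\<close> one at a time. Either the cofactor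
  \<open>g\<close> still kills \<open>v\<close>, or g(T) v is nonzero, is an eigenvector of
  \<open>T\<close> for the root split off, and remains an eigenvector of \<open>U\<close> by
  commutation.\<close>

lemma commuting_eigenvector:
  assumes T: "lin_op X T" and U: "lin_op X U"
    and comm: "\<And>v. v \<in> fun_on X \<Longrightarrow> U (T v) = T (U v)"
    and v: "v \<in> fun_on X" "v \<noteq> (\<lambda>x. 0)" "U v = (\<lambda>x. \<mu> * v x)"
    and "f \<noteq> 0" "poly_op T f v = (\<lambda>x. 0)"
  obtains w \<zeta> where "w \<in> fun_on X" "w \<noteq> (\<lambda>x. 0)" "U w = (\<lambda>x. \<mu> * w x)"
    "T w = (\<lambda>x. \<zeta> * w x)" "poly f \<zeta> = 0"
proof -
  have "\<exists>w \<zeta>. w \<in> fun_on X \<and> w \<noteq> (\<lambda>x. 0) \<and> U w = (\<lambda>x. \<mu> * w x) \<and> T w = (\<lambda>x. \<zeta> * w x) \<and> poly f \<zeta> = 0"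
    using assms(7,8)
  proof (induction "degree f" arbitrary: f)
    case 0
    then obtain a where "f = [:a:]" "a \<noteq> 0"
      by (metis degree_eq_zeroE pCons_0_0)
    then show ?case
      using 0 v(2) by (auto simp: poly_op_pCons[OF T] lin_op_zero[OF T] fun_eq_iff)
  next
    case (Suc d)
    then obtain \<zeta> where \<zeta>: "poly f \<zeta> = 0"
      using fundamental_theorem_of_algebra[of f] by (metis constant_degree nat.distinct(1))
    then obtain g where g: "f = [:- \<zeta>, 1:] * g"
      unfolding poly_eq_0_iff_dvd by (elim dvdE)
    have "g \<noteq> 0" using Suc.prems(1) g by auto
    then have deg: "d = degree g"
      using Suc.hyps(2) degree_mult_eq[of "[:- \<zeta>, 1:]" g] unfolding g by simp
    show ?case
    proof (cases "poly_op T g v = (\<lambda>x. 0)")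
      case True
      then show ?thesis
        using Suc.hyps(1)[OF deg \<open>g \<noteq> 0\<close>] g by (metis mult_eq_0_iff poly_mult)
    next
      case False
      let ?w = "poly_op T g v"
      have "U ?w = poly_op T g (\<lambda>x. \<mu> * v x)"
        using poly_op_commute[OF T U comm v(1)] v(3) by simp
      also have "\<dots> = (\<lambda>x. \<mu> * ?w x)"
        by (rule lin_op_smult[OF lin_op_poly_op[OF T] v(1)])
      finally have "U ?w = (\<lambda>x. \<mu> * ?w x)" .
      moreover have "T ?w = (\<lambda>x. \<zeta> * ?w x)"
        using Suc.prems(2) poly_op_mult[OF T v(1), of "[:- \<zeta>, 1:]" g] unfolding g
        by (simp add: poly_op_pCons[OF T] lin_op_zero[OF T] fun_eq_iff)
      ultimately show ?thesis
        using \<zeta> False poly_op_closed[OF T v(1), of g] by blast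
    qed
  qed
  then show ?thesis using that by blast
qed

subsection \<open>Cyclotomic integers\<close>

text \<open>For finite \<open>W\<close> this is the additive group generated by \<open>W\<close>; a
  number that maps such a group into itself by multiplication is an algebraic integer.\<close>

definition int_span :: "complex set \<Rightarrow> complex set" where
  "int_span W = {\<Sum>w\<in>W. of_int (a w) * w |a. True}"

lemma int_span_0 [simp]: "0 \<in> int_span W"
  unfolding int_span_def by (intro CollectI exI[of _ "\<lambda>_. 0"]) simp

lemma int_span_add:
  assumes "x \<in> int_span W" "y \<in> int_span W"
  shows "x + y \<in> int_span W"
proof -
  obtain a b where "x = (\<Sum>w\<in>W. of_int (a w) * w)" "y = (\<Sum>w\<in>W. of_int (b w) * w)"
    using assms unfolding int_span_def by auto
  then have "x + y = (\<Sum>w\<in>W. of_int (a w + b w) * w)"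
    by (simp add: sum.distrib algebra_simps)
  then show ?thesis unfolding int_span_def by (intro CollectI exI[of _ "\<lambda>w. a w + b w"]) simp
qed

lemma int_span_of_int_mult:
  assumes "x \<in> int_span W"
  shows "of_int k * x \<in> int_span W"
proof -
  obtain a where "x = (\<Sum>w\<in>W. of_int (a w) * w)"
    using assms unfolding int_span_def by auto
  then have "of_int k * x = (\<Sum>w\<in>W. of_int (k * a w) * w)"
    by (simp add: sum_distrib_left algebra_simps)
  then show ?thesis unfolding int_span_def by (intro CollectI exI[of _ "\<lambda>w. k * a w"]) simp
qed

lemma int_span_base:
  assumes "finite W" "w \<in> W"
  shows "w \<in> int_span W"
proof -
  have "w = (\<Sum>u\<in>W. of_int (if u = w then 1 else 0) * u)"
    using assms by (simp add: if_distrib if_distribR cong: if_cong)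
  then show ?thesis unfolding int_span_def by (intro CollectI exI[of _ "\<lambda>u. if u = w then 1 else 0"]) simp
qed

lemma int_span_sum: "(\<And>i. i \<in> I \<Longrightarrow> f i \<in> int_span W) \<Longrightarrow> (\<Sum>i\<in>I. f i) \<in> int_span W"
  by (induction I rule: infinite_finite_induct) (auto intro: int_span_add)

text \<open>The characteristic polynomial of \<open>A\<close> is monic with integer
  coefficients.\<close>

lemma algebraic_int_eigenvalue_int_mat:
  fixes A :: "int mat"
  assumes A: "A \<in> carrier_mat n n" and ev: "eigenvalue (map_mat of_int A :: complex mat) x"
  shows "algebraic_int x"
proof -
  have A': "(map_mat of_int A :: complex mat) \<in> carrier_mat n n" using A by simp
  have "poly (map_poly of_int (char_poly A)) x = 0"
    using eigenvalue_root_char_poly[OF A'] ev of_int_hom.char_poly_hom[OF A, where ?'a = complex]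
    by simp
  moreover have "lead_coeff (char_poly A) = 1"
    using degree_monic_char_poly[OF A] by simp
  ultimately show ?thesis
    unfolding algebraic_int_altdef_ipoly by blast
qed

text \<open>Multiplication by \<open>x\<close> acts on the vector of elements of \<open>W\<close> through an integer matrix.\<close>

lemma algebraic_int_int_span:
  assumes "finite W" "w0 \<in> W" "w0 \<noteq> 0" and mult: "\<And>w. w \<in> W \<Longrightarrow> x * w \<in> int_span W"
  shows "algebraic_int x"
proof -
  have "\<forall>w\<in>W. \<exists>a. x * w = (\<Sum>u\<in>W. of_int (a u) * u)"
    using mult unfolding int_span_def by blast
  then obtain a where a: "\<And>w. w \<in> W \<Longrightarrow> x * w = (\<Sum>u\<in>W. of_int (a w u) * u)"
    by metis
  obtain ws where ws: "distinct ws" "set ws = W"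
    using finite_distinct_list[OF assms(1)] by blast
  let ?n = "length ws"
  let ?A = "mat ?n ?n (\<lambda>(i, j). a (ws ! i) (ws ! j))"
  let ?v = "vec ?n (\<lambda>i. ws ! i)"
  have "(map_mat of_int ?A :: complex mat) *\<^sub>v ?v = x \<cdot>\<^sub>v ?v"
  proof (rule eq_vecI)
    fix i assume "i < dim_vec (x \<cdot>\<^sub>v ?v)"
    then have i: "i < ?n" by simp
    then have "x * ws ! i = (\<Sum>u\<in>W. of_int (a (ws ! i) u) * u)"
      using a ws nth_mem by metis
    also have "\<dots> = (\<Sum>j<?n. of_int (a (ws ! i) (ws ! j)) * ws ! j)"
      using sum.reindex_bij_betw[OF bij_betw_nth[OF ws(1) refl ws(2)[symmetric]], of "\<lambda>u. of_int (a (ws ! i) u) * u"]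
      by simp
    finally show "((map_mat of_int ?A :: complex mat) *\<^sub>v ?v) $ i = (x \<cdot>\<^sub>v ?v) $ i"
      using i by (simp add: scalar_prod_def atLeast0LessThan)
  qed simp
  moreover obtain i where "i < ?n" "ws ! i = w0"
    using assms(2) ws by (metis in_set_conv_nth)
  then have "?v \<noteq> 0\<^sub>v ?n"
    using assms(3) by (metis index_vec index_zero_vec(1))
  ultimately have "eigenvalue (map_mat of_int ?A :: complex mat) x"
    unfolding eigenvalue_def eigenvector_def by (intro exI[of _ ?v]) simp
  then show ?thesis
    by (rule algebraic_int_eigenvalue_int_mat[OF mat_carrier])
qed

lemma algebraic_int_Rats_imp_Ints:
  fixes x :: complex
  assumes "algebraic_int x" "x \<in> \<rat>"
  shows "x \<in> \<int>"
  using rational_algebraic_int_is_int assms by blast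

text \<open>The ring generated by \<open>z\<close> over the integers, given inductively so that its
  properties follow by rule induction.\<close>

inductive_set int_adjoin :: "complex \<Rightarrow> complex set" for z where
  gen [simp]: "z \<in> int_adjoin z"
| of_int [simp]: "of_int k \<in> int_adjoin z"
| add: "x \<in> int_adjoin z \<Longrightarrow> y \<in> int_adjoin z \<Longrightarrow> x + y \<in> int_adjoin z"
| mult: "x \<in> int_adjoin z \<Longrightarrow> y \<in> int_adjoin z \<Longrightarrow> x * y \<in> int_adjoin z"

lemmas int_adjoin_add [intro] = int_adjoin.add
lemmas int_adjoin_mult [intro] = int_adjoin.mult

lemma int_adjoin_of_nat [simp]: "of_nat k \<in> int_adjoin z"
  using int_adjoin.of_int[of "int k"] by simp

lemma int_adjoin_uminus [intro]: "x \<in> int_adjoin z \<Longrightarrow> - x \<in> int_adjoin z"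
  using int_adjoin_mult[OF int_adjoin.of_int[of "-1"], of x] by simp

lemma int_adjoin_diff [intro]: "x \<in> int_adjoin z \<Longrightarrow> y \<in> int_adjoin z \<Longrightarrow> x - y \<in> int_adjoin z"
  using int_adjoin_add[OF _ int_adjoin_uminus, of x z y] by simp

lemma int_adjoin_power [intro]: "x \<in> int_adjoin z \<Longrightarrow> x ^ n \<in> int_adjoin z"
  using int_adjoin.of_int[of 1] by (induction n) auto

lemma int_adjoin_sum [intro]: "(\<And>i. i \<in> I \<Longrightarrow> f i \<in> int_adjoin z) \<Longrightarrow> (\<Sum>i\<in>I. f i) \<in> int_adjoin z"
  using int_adjoin.of_int[of 0] by (induction I rule: infinite_finite_induct) auto

section \<open>Roots of unity and the ring they generate\<close>

lemma power_mod_unity: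
  fixes z :: complex
  assumes "z ^ n = 1"
  shows "z ^ (i mod n) = z ^ i"
proof -
  have "z ^ i = z ^ (n * (i div n) + i mod n)" by simp
  also have "\<dots> = z ^ (i mod n)"
    by (simp only: power_add power_mult assms power_one mult_1)
  finally show ?thesis by simp
qed

lemma geometric_sum_unity:
  fixes \<zeta> :: complex
  assumes "\<zeta> ^ n = 1"
  shows "(\<Sum>i<n. \<zeta> ^ i) = (if \<zeta> = 1 then of_nat n else 0)"
  using assms by (auto simp: geometric_sum)

text \<open>On the unit circle conjugation is inversion, so \<open>cnj z\<close> is
  \<open>z ^ (n - 1)\<close>.\<close>

lemma int_adjoin_cnj:
  assumes "x \<in> int_adjoin z" "z ^ n = 1" "n > 0"
  shows "cnj x \<in> int_adjoin z"
proof -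
  have "norm z = 1"
    using assms(2,3) by (metis norm_one norm_power power_eq_1_iff norm_ge_zero less_not_refl2)
  then have "z * cnj z = 1"
    using complex_norm_square[of z] by simp
  moreover have "z * z ^ (n - 1) = 1"
    using assms(2,3) by (metis power_eq_if not_gr0)
  ultimately have cz: "cnj z = z ^ (n - 1)"
    by (metis mult.assoc mult.commute mult.right_neutral)
  show ?thesis
    using assms(1) by induction (auto simp: cz)
qed

text \<open>The powers of \<open>z\<close> below \<open>n\<close> span an additive group that
  contains 1 and is stable under multiplication by the whole ring.\<close>

lemma int_adjoin_algebraic_int:
  assumes "x \<in> int_adjoin z" "z ^ n = 1" "n > 0"
  shows "algebraic_int x"
proof -
  let ?W = "(\<lambda>i. z ^ i) ` {..<n}"
  have "x * w \<in> int_span ?W" if "w \<in> int_span ?W" for w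
    using assms(1) that
  proof (induction arbitrary: w)
    case gen
    obtain a where w: "w = (\<Sum>u\<in>?W. of_int (a u) * u)"
      using gen unfolding int_span_def by auto
    have "z * z ^ i \<in> int_span ?W" for i
    proof -
      have "z * z ^ i = z ^ (Suc i mod n)"
        using power_mod_unity[OF assms(2), of "Suc i"] by simp
      then show ?thesis
        using assms(3) by (intro int_span_base) auto
    qed
    then have "of_int (a u) * (z * u) \<in> int_span ?W" if "u \<in> ?W" for u
      using that by (auto intro: int_span_of_int_mult)
    then have "(\<Sum>u\<in>?W. of_int (a u) * (z * u)) \<in> int_span ?W"
      by (rule int_span_sum)
    then show ?case
      unfolding w sum_distrib_left by (simp only: mult.left_commute)
  qed (auto simp: ring_distribs mult.assoc intro: int_span_add int_span_of_int_mult)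
  moreover have "1 \<in> ?W"
    using assms(3) by (intro image_eqI[of _ _ 0]) auto
  ultimately show ?thesis
    by (intro algebraic_int_int_span[of ?W 1]) (auto intro: int_span_base)
qed

text \<open>The inner binomial coefficients are multiples of \<open>p\<close>, so raising to the
  power \<open>p\<close> is additive modulo \<open>p\<close> in the ring.\<close>

lemma int_adjoin_frobenius:
  fixes f :: "'b \<Rightarrow> complex"
  assumes p: "prime p" and f: "\<And>i. i \<in> I \<Longrightarrow> f i \<in> int_adjoin z"
  shows "\<exists>b\<in>int_adjoin z. (\<Sum>i\<in>I. f i) ^ p = (\<Sum>i\<in>I. f i ^ p) + of_nat p * b"
  using f
proof (induction I rule: infinite_finite_induct)
  case (insert i I)
  then obtain b where b: "b \<in> int_adjoin z" "(\<Sum>i\<in>I. f i) ^ p = (\<Sum>i\<in>I. f i ^ p) + of_nat p * b"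
    by auto
  let ?s = "\<Sum>i\<in>I. f i"
  have s: "?s \<in> int_adjoin z" using insert by auto
  define c where "c = (\<Sum>k\<in>{1..<p}. of_nat ((p choose k) div p) * f i ^ k * ?s ^ (p - k))"
  have c: "c \<in> int_adjoin z"
    unfolding c_def using insert s by (intro int_adjoin_sum int_adjoin_mult int_adjoin_of_nat int_adjoin_power) auto
  have "p > 0" using p prime_gt_0_nat by blast
  have split: "{..p} = insert 0 (insert p {1..<p})" using \<open>p > 0\<close> by auto
  have "(f i + ?s) ^ p = (\<Sum>k\<le>p. of_nat (p choose k) * f i ^ k * ?s ^ (p - k))"
    by (rule binomial_ring)
  also have "\<dots> = f i ^ p + ?s ^ p + (\<Sum>k\<in>{1..<p}. of_nat (p choose k) * f i ^ k * ?s ^ (p - k))"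
    using \<open>p > 0\<close> unfolding split by simp
  also have "(\<Sum>k\<in>{1..<p}. of_nat (p choose k) * f i ^ k * ?s ^ (p - k)) = of_nat p * c"
    unfolding c_def sum_distrib_left
  proof (rule sum.cong)
    fix k assume "k \<in> {1..<p}"
    then have "p dvd (p choose k)" using p by (intro dvd_choose_prime) auto
    then have "of_nat (p choose k) = (of_nat p * of_nat ((p choose k) div p) :: complex)"
      by (metis dvd_mult_div_cancel of_nat_mult)
    then show "of_nat (p choose k) * f i ^ k * ?s ^ (p - k)
        = of_nat p * (of_nat ((p choose k) div p) * f i ^ k * ?s ^ (p - k))"
      by simp
  qed simp
  finally have "(f i + ?s) ^ p = f i ^ p + (\<Sum>i\<in>I. f i ^ p) + of_nat p * (b + c)"
    using b(2) by (simp add: algebra_simps)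
  then show ?case using insert(1,2) b(1) c by (intro bexI[of _ "b + c"]) auto
next
  case empty
  then show ?case using p prime_gt_0_nat[of p] int_adjoin.of_int[of 0] by (intro bexI[of _ 0]) auto
next
  case (infinite I)
  then show ?case using p prime_gt_0_nat[of p] int_adjoin.of_int[of 0] by (intro bexI[of _ 0]) auto
qed

text \<open>Fermat's little theorem as an equation between complex numbers, ready to be combined
  with the Frobenius congruence.\<close>

lemma fermat_of_int:
  assumes "prime p"
  shows "\<exists>k. (of_int t :: complex) ^ p = of_int t + of_nat p * of_int k"
proof -
  have "t ^ p mod int p = t mod int p"
  proof -
    define a where "a = nat (t mod int p)"
    have "p > 0" using assms prime_gt_0_nat by blast
    then have a: "int a = t mod int p" by (simp add: a_def)
    have "[a ^ p = a] (mod p)"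
    proof (cases "p dvd a")
      case True
      then have "p dvd a ^ p" using \<open>p > 0\<close> by (simp add: dvd_power_le dvd_trans dvd_power)
      with True show ?thesis by (simp add: cong_def dvd_eq_mod_eq_0)
    next
      case False
      then have "[a ^ (p - 1) * a = 1 * a] (mod p)"
        using fermat_theorem[OF assms] by (intro cong_mult cong_refl) auto
      then show ?thesis using \<open>p > 0\<close> by (metis mult_1 power_minus_mult)
    qed
    then have "[int a ^ p = int a] (mod int p)"
      by (metis cong_int_iff of_nat_power)
    then show ?thesis by (simp add: a cong_def power_mod)
  qed
  then obtain k where "t ^ p = t + int p * k"
    by (metis mod_eqE add.commute diff_eq_eq mod_eq_dvd_iff dvdE)
  then show ?thesis by (metis of_int_add of_int_mult of_int_of_nat_eq of_int_power)
qed

text \<open>Sorting the exponents 1, ..., n by their gcd with \<open>n\<close> splits the full power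
  sum, which is \<open>n\<close> or 0, into Ramanujan sums of \<open>\<eta> ^ d\<close> modulo
  \<open>n div d\<close>. All of them except the one for d = 1 have smaller modulus and are integers
  by induction.\<close>

lemma ramanujan_sum_Ints:
  fixes \<eta> :: complex
  assumes "n > 0" "\<eta> ^ n = 1"
  shows "(\<Sum>k\<in>totatives n. \<eta> ^ k) \<in> \<int>"
  using assms
proof (induction n arbitrary: \<eta> rule: less_induct)
  case (less n)
  define D where "D = {d. d dvd n}"
  define A where "A d = {k\<in>{0<..n}. gcd k n = d}" for d
  have fin: "finite D" using less.prems by (simp add: D_def)
  have one: "1 \<in> D" by (simp add: D_def)
  have inner: "(\<Sum>k\<in>A d. \<eta> ^ k) = (\<Sum>k\<in>totatives (n div d). (\<eta> ^ d) ^ k)" if "d \<in> D" for d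
    using sum.reindex_bij_betw[OF bij_betw_totatives_gcd_eq[of d n], of "\<lambda>k. \<eta> ^ k"] less.prems(1) that
    by (simp add: A_def D_def power_mult mult.commute flip: power_mult)
  have "(\<Sum>k\<in>{0<..n}. \<eta> ^ k) = (\<Sum>d\<in>D. \<Sum>k\<in>A d. \<eta> ^ k)"
  proof -
    have "{0<..n} = (\<Union>d\<in>D. A d)" by (auto simp: A_def D_def)
    then show ?thesis
      by (simp only:) (rule sum.UNION_disjoint, auto simp: fin A_def)
  qed
  also have "\<dots> = (\<Sum>k\<in>totatives n. \<eta> ^ k) + (\<Sum>d\<in>D - {1}. \<Sum>k\<in>totatives (n div d). (\<eta> ^ d) ^ k)"
    using sum.remove[OF fin one, of "\<lambda>d. \<Sum>k\<in>A d. \<eta> ^ k"] inner inner[OF one] by simp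
  finally have eq: "(\<Sum>k\<in>totatives n. \<eta> ^ k)
      = (\<Sum>k\<in>{0<..n}. \<eta> ^ k) - (\<Sum>d\<in>D - {1}. \<Sum>k\<in>totatives (n div d). (\<eta> ^ d) ^ k)"
    by simp
  have "(\<Sum>k\<in>totatives (n div d). (\<eta> ^ d) ^ k) \<in> \<int>" if "d \<in> D - {1}" for d
  proof (rule less.IH)
    have d: "d dvd n" "d \<noteq> 1" "d \<noteq> 0" using that less.prems(1) by (auto simp: D_def)
    then show "n div d < n" using less.prems(1) by (intro div_less_dividend) auto
    show "n div d > 0" using d less.prems(1) by (simp add: div_greater_zero_iff dvd_imp_le)
    show "(\<eta> ^ d) ^ (n div d) = 1" using d less.prems by (simp flip: power_mult)
  qed
  moreover have "(\<Sum>k\<in>{0<..n}. \<eta> ^ k) \<in> \<int>"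
  proof (cases "\<eta> = 1")
    case False
    have "(\<Sum>k\<in>{0<..n}. \<eta> ^ k) = \<eta> * (\<Sum>k<n. \<eta> ^ k)"
      unfolding sum_distrib_left
      by (rule sum.reindex_bij_witness[of _ Suc "\<lambda>k. k - 1"]) (auto simp flip: power_Suc)
    also have "(\<Sum>k<n. \<eta> ^ k) = 0"
      using False less.prems by (simp add: geometric_sum)
    finally show ?thesis by simp
  qed simp
  ultimately show ?case unfolding eq by (intro Ints_diff Ints_sum[where A = "D - {1}"])
qed

text \<open>By the Chinese remainder theorem \<open>k'\<close> is prescribed modulo \<open>N\<close>
  and is 1 modulo the product \<open>M\<close> of the small primes not dividing \<open>N\<close>.
  Primes dividing \<open>N\<close> are excluded because \<open>k\<close> is coprime to
  \<open>N\<close>.\<close>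

lemma large_prime_lift:
  fixes k N B :: nat
  assumes "coprime k N" "N > 0"
  obtains k' where "[k' = k] (mod N)" "k' > 0" "\<And>p. prime p \<Longrightarrow> p dvd k' \<Longrightarrow> p > B"
proof -
  define M where "M = (\<Prod>p\<in>{p. prime p \<and> p \<le> B \<and> \<not> p dvd N}. p)"
  have fin: "finite {p. prime p \<and> p \<le> B \<and> \<not> p dvd N}"
    by (rule finite_subset[of _ "{..B}"]) auto
  have "coprime N M"
    unfolding M_def using prime_imp_coprime by (intro prod_coprime_right) (auto simp: coprime_commute)
  then obtain x where x: "[x = k] (mod N)" "[x = 1] (mod M)"
    using binary_chinese_remainder_nat by blast
  \<comment> \<open>Adding \<open>N * M\<close> keeps both residues and makes the number
    positive.\<close>
  define k' where "k' = x + N * M"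
  have "M > 0" unfolding M_def by (intro prod_pos) (auto simp: prime_gt_0_nat)
  have 1: "[k' = k] (mod N)" "[k' = 1] (mod M)"
    using x by (auto simp: k'_def cong_def)
  moreover have "p > B" if p: "prime p" "p dvd k'" for p
  proof (rule ccontr)
    assume "\<not> p > B"
    show False
    proof (cases "p dvd N")
      case True
      then have "p dvd k" using 1(1) p(2) by (meson cong_dvd_iff cong_dvd_modulus_nat)
      with True assms(1) p(1) show False
        by (metis coprime_common_divisor not_prime_unit)
    next
      case False
      then have "p dvd M"
        unfolding M_def using p(1) \<open>\<not> p > B\<close> fin by (intro dvd_prodI) auto
      then have "p dvd 1" using 1(2) p(2) by (meson cong_dvd_iff cong_dvd_modulus_nat)
      with p(1) show False by simp
    qed
  qed
  moreover have "k' > 0" using \<open>M > 0\<close> assms(2) by (simp add: k'_def)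
  ultimately show ?thesis using that by blast
qed

subsection \<open>The operator of a normal oriented Cayley graph\<close>

text \<open>A primitive sixth root of unity, the matrix entry at a one-way arc.\<close>

definition omega6 :: complex where
  "omega6 = (1 + \<i> * complex_of_real (sqrt 3)) / 2"

section \<open>Galois action on the matrix entries\<close>

lemma cnj_omega6: "cnj omega6 = (1 - \<i> * complex_of_real (sqrt 3)) / 2"
  by (simp add: omega6_def complex_eq_iff)

lemma cnj_omega6_eq: "cnj omega6 = 1 - omega6"
  by (simp add: omega6_def complex_eq_iff)

lemma omega6_square: "omega6 * omega6 = omega6 - 1"
  by (simp add: omega6_def complex_eq_iff)

lemma omega6_neq_cnj: "omega6 \<noteq> cnj omega6"
  by (simp add: omega6_def complex_eq_iff)

lemma omega6_neq_0: "omega6 \<noteq> 0"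
  by (simp add: omega6_def complex_eq_iff)

abbreviation hs_values :: "complex set" where
  "hs_values \<equiv> {0, omega6, cnj omega6}"

lemma hs_values_square:
  assumes "x \<in> hs_values" "x \<noteq> 0"
  shows "x * x = x - 1" "cnj x = 1 - x"
proof -
  consider "x = omega6" | "x = cnj omega6" using assms by auto
  then have "x * x = x - 1 \<and> cnj x = 1 - x"
  proof cases
    case 1
    then show ?thesis by (simp add: omega6_square cnj_omega6_eq)
  next
    case 2
    have "cnj omega6 * cnj omega6 = cnj omega6 - 1"
      by (metis omega6_square complex_cnj_diff complex_cnj_mult complex_cnj_one)
    then show ?thesis using 2 by (simp add: cnj_omega6_eq)
  qed
  then show "x * x = x - 1" "cnj x = 1 - x" by auto
qed

text \<open>The sign turns a sixth root of unity into a cube root of unity, on which the Galois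
  action is a power map.\<close>

lemma neg_cube_hs_values:
  assumes "x \<in> hs_values" "x \<noteq> 0"
  shows "(- x) ^ 3 = 1"
proof -
  have "x * x * x = (x - 1) * x" by (simp only: hs_values_square(1)[OF assms])
  also have "\<dots> = -1" using hs_values_square(1)[OF assms] by (simp add: left_diff_distrib)
  finally show ?thesis by (simp add: power3_eq_cube)
qed

text \<open>The Galois automorphism of \<open>\<rat>(\<surd>-3)\<close> induced by raising roots of unity
  to the power \<open>k\<close>, for \<open>k\<close> not divisible by \<open>3\<close>; other \<open>k\<close> give a junk value.\<close>

definition gal :: "nat \<Rightarrow> complex \<Rightarrow> complex" where
  "gal k x = (if k mod 3 = 1 then x else cnj x)"

text \<open>For nonzero \<open>x\<close> the power of \<open>- x\<close> depends only on
  \<open>k\<close> modulo 3: it is \<open>- x\<close> or its square, which is its conjugate. For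
  \<open>x = 0\<close> both sides vanish because \<open>k\<close> is nonzero.\<close>

lemma gal_eq_power:
  assumes x: "x \<in> hs_values" and k: "\<not> 3 dvd k"
  shows "gal k x = - ((- x) ^ k)"
proof (cases "x = 0")
  case True
  have "k \<noteq> 0" using k by (intro notI) simp
  with True show ?thesis by (simp add: gal_def)
next
  case False
  note sq = hs_values_square[OF x False]
  have pk: "(- x) ^ (k mod 3) = (- x) ^ k"
    by (rule power_mod_unity[OF neg_cube_hs_values[OF x False]])
  have "k mod 3 = 1 \<or> k mod 3 = 2"
    using k by presburger
  then show ?thesis
    using sq by (elim disjE) (simp_all add: gal_def power2_eq_square flip: pk)
qed

text \<open>The three values form a triangle with sides 1, 1 and the square root of 3. Later uses
  are that the squared distance is rational and at most 4.\<close>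

lemma hs_values_diff_norm:
  assumes "x \<in> hs_values" "y \<in> hs_values"
  shows "(cmod (x - y))\<^sup>2 \<in> {0, 1, 3}"
proof -
  have ReIm: "Re omega6 = 1 / 2" "Im omega6 = sqrt 3 / 2"
    by (simp_all add: omega6_def)
  from assms show ?thesis
    by (elim insertE emptyE) (simp_all add: cmod_power2 ReIm power_divide)
qed

lemma not_dvd_3_cases: "\<not> 3 dvd (k :: nat) \<Longrightarrow> k mod 3 = 1 \<or> k mod 3 = 2"
  by presburger

lemma gal_mult:
  assumes "\<not> 3 dvd a" "\<not> 3 dvd b"
  shows "gal (a * b) x = gal b (gal a x)"
proof -
  note not_dvd_3_cases[OF assms(1)] not_dvd_3_cases[OF assms(2)]
  moreover have "a * b mod 3 = (a mod 3) * (b mod 3) mod 3"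
    by (simp add: mod_mult_eq)
  ultimately show ?thesis by (auto simp: gal_def)
qed

text \<open>Left translation of the argument, cut off outside the group so that the result lies in
  \<open>fun_on\<close>. It reverses products, see \<open>shift_shift\<close>.\<close>

definition shift :: "('a, 'b) monoid_scheme \<Rightarrow> 'a \<Rightarrow> ('a \<Rightarrow> complex) \<Rightarrow> 'a \<Rightarrow> complex" where
  "shift G t v = (\<lambda>u. if u \<in> carrier G then v (t \<otimes>\<^bsub>G\<^esub> u) else 0)"

locale skew_normal = group G for G (structure) +
  fixes S :: "'a set"
  assumes fin: "finite (carrier G)"
    and sub: "S \<subseteq> carrier G"
    and conj_closed: "\<And>g s. g \<in> carrier G \<Longrightarrow> s \<in> S \<Longrightarrow> g \<otimes> s \<otimes> inv g \<in> S"
    and skew: "\<And>s. s \<in> S \<Longrightarrow> inv s \<notin> S"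
begin

abbreviation "X \<equiv> carrier G"

text \<open>Skew-symmetry excludes two-way arcs, so the entry 1 never arises.\<close>

definition coef :: "'a \<Rightarrow> complex" where
  "coef t = (if t \<in> S then omega6 else if inv t \<in> S then cnj omega6 else 0)"

definition hs_op :: "('a \<Rightarrow> complex) \<Rightarrow> 'a \<Rightarrow> complex" where
  "hs_op v = (\<lambda>u. \<Sum>t\<in>X. coef t * shift G t v u)"

section \<open>Translations and the adjacency operator\<close>

lemma l_cancel_inv:
  assumes "s \<in> X" "t \<in> X"
  shows "inv s \<otimes> (s \<otimes> t) = t" "s \<otimes> (inv s \<otimes> t) = t"
  using assms by (simp_all flip: m_assoc)

lemma coef_values: "coef t \<in> hs_values"
  by (simp add: coef_def)

lemma conj_closed_iff:
  assumes "g \<in> X" "t \<in> X"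
  shows "g \<otimes> t \<otimes> inv g \<in> S \<longleftrightarrow> t \<in> S"
proof
  assume "g \<otimes> t \<otimes> inv g \<in> S"
  then have "inv g \<otimes> (g \<otimes> t \<otimes> inv g) \<otimes> inv (inv g) \<in> S"
    by (rule conj_closed[rotated]) (use assms in simp)
  moreover have "inv g \<otimes> (g \<otimes> t \<otimes> inv g) \<otimes> inv (inv g) = t"
    using assms by (simp add: m_assoc l_cancel_inv)
  ultimately show "t \<in> S" by (simp only:)
qed (use assms conj_closed in auto)

lemma coef_conj:
  assumes "g \<in> X" "t \<in> X"
  shows "coef (g \<otimes> t \<otimes> inv g) = coef t"
proof -
  have "inv (g \<otimes> t \<otimes> inv g) = g \<otimes> inv t \<otimes> inv g"
    using assms by (simp add: inv_mult_group m_assoc)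
  then show ?thesis
    using assms conj_closed_iff by (simp add: coef_def)
qed

lemma lin_op_shift: "t \<in> X \<Longrightarrow> lin_op X (shift G t)"
  by (auto simp: lin_op_def shift_def fun_on_def)

lemma lin_op_hs: "lin_op X hs_op"
  unfolding hs_op_def[abs_def] by (intro lin_op_lincomb lin_op_shift)

lemma shift_shift: "s \<in> X \<Longrightarrow> t \<in> X \<Longrightarrow> shift G s (shift G t v) = shift G (t \<otimes> s) v"
  by (auto simp: shift_def m_assoc)

lemma shift_one: "v \<in> fun_on X \<Longrightarrow> shift G \<one> v = v"
  by (auto simp: shift_def fun_on_def)

lemma shift_pow: "t \<in> X \<Longrightarrow> v \<in> fun_on X \<Longrightarrow> (shift G t ^^ k) v = shift G (t [^] k) v"
  by (induction k) (simp_all add: shift_one shift_shift)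

text \<open>Conjugating the summation index by \<open>s\<close> interchanges the two translations,
  and \<open>coef\<close> is constant on conjugacy classes. This is where normality enters.\<close>

lemma hs_op_shift:
  assumes s: "s \<in> X"
  shows "hs_op (shift G s v) = shift G s (hs_op v)"
proof
  fix u
  show "hs_op (shift G s v) u = shift G s (hs_op v) u"
  proof (cases "u \<in> X")
    case True
    have "hs_op (shift G s v) u = (\<Sum>t\<in>X. coef t * v (s \<otimes> (t \<otimes> u)))"
      using True by (simp add: hs_op_def shift_def)
    also have "\<dots> = (\<Sum>t\<in>X. coef t * v (t \<otimes> (s \<otimes> u)))"
    proof (rule sum.reindex_bij_witness[of _ "\<lambda>t. inv s \<otimes> t \<otimes> s" "\<lambda>t. s \<otimes> t \<otimes> inv s"])
      fix t assume t: "t \<in> X"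
      show "inv s \<otimes> (s \<otimes> t \<otimes> inv s) \<otimes> s = t" "s \<otimes> (inv s \<otimes> t \<otimes> s) \<otimes> inv s = t"
        using s t by (simp_all add: m_assoc l_cancel_inv)
      have "s \<otimes> t \<otimes> inv s \<otimes> (s \<otimes> u) = s \<otimes> (t \<otimes> u)"
        using s t True by (simp add: m_assoc l_cancel_inv)
      then show "coef (s \<otimes> t \<otimes> inv s) * v (s \<otimes> t \<otimes> inv s \<otimes> (s \<otimes> u)) = coef t * v (s \<otimes> (t \<otimes> u))"
        using s t by (simp add: coef_conj)
    qed (use s in auto)
    also have "\<dots> = shift G s (hs_op v) u"
      using True s by (simp add: hs_op_def shift_def)
    finally show ?thesis .
  next
    case False
    then show ?thesis by (simp add: hs_op_def shift_def)
  qed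
qed

text \<open>On the diagonal only the term with \<open>t = inv s\<close> survives, so traces read off
  single coefficients.\<close>

lemma op_trace_hs_shift:
  assumes s: "s \<in> X"
  shows "op_trace X (\<lambda>v. hs_op (shift G s v)) = of_nat (card X) * coef (inv s)"
proof -
  have "hs_op (shift G s (delta u)) u = coef (inv s)" if u: "u \<in> X" for u
  proof -
    have "hs_op (shift G s (delta u)) u = (\<Sum>t\<in>X. coef t * (if t = inv s then 1 else 0))"
      unfolding hs_op_def
    proof (rule sum.cong)
      fix t assume t: "t \<in> X"
      have "s \<otimes> (t \<otimes> u) = u \<longleftrightarrow> t = inv s"
        using s t u by (metis inv_closed inv_equality inv_inv l_one m_assoc m_closed r_cancel_one r_inv)
      then show "coef t * shift G t (shift G s (delta u)) u = coef t * (if t = inv s then 1 else 0)"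
        using s t u by (simp add: shift_def delta_def)
    qed simp
    then show ?thesis using s fin by (simp add: if_distrib cong: if_cong)
  qed
  then show ?thesis by (simp add: op_trace_def)
qed

lemma hs_op_delta:
  assumes "x \<in> X" "y \<in> X"
  shows "hs_op (delta y) x = coef (y \<otimes> inv x)"
proof -
  have "hs_op (delta y) x = (\<Sum>t\<in>X. coef t * (if t = y \<otimes> inv x then 1 else 0))"
    unfolding hs_op_def
  proof (rule sum.cong)
    fix t assume t: "t \<in> X"
    have "t \<otimes> x = y \<longleftrightarrow> t = y \<otimes> inv x"
      using assms t by (metis inv_solve_right)
    then show "coef t * shift G t (delta y) x = coef t * (if t = y \<otimes> inv x then 1 else 0)"
      using assms t by (simp add: shift_def delta_def)
  qed simp
  then show ?thesis using assms fin by (simp add: if_distrib cong: if_cong)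
qed

lemma hs_entry_eq_coef:
  assumes "x \<in> X" "y \<in> X"
  shows "hs_entry (cayley_graph G S) x y = coef (y \<otimes> inv x)"
proof -
  have "inv (y \<otimes> inv x) = x \<otimes> inv y"
    using assms by (simp add: inv_mult_group)
  then show ?thesis
    using assms skew[of "y \<otimes> inv x"]
    by (auto simp: hs_entry_def cayley_graph_def coef_def cnj_omega6 omega6_def)
qed

text \<open>In every vertex ordering the matrix represents \<open>hs_op\<close> in the delta basis.
  Finiteness supplies an ordering, so the quantifier over orderings is not vacuous.\<close>

lemma HS_integral_iff: "HS_integral (cayley_graph G S) \<longleftrightarrow> (\<forall>\<mu>. op_eigenvalue X hs_op \<mu> \<longrightarrow> \<mu> \<in> \<int>)"
proof -
  have eq: "eigenvalue (hs_matrix (cayley_graph G S) vs) \<mu> \<longleftrightarrow> op_eigenvalue X hs_op \<mu>"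
    if vs: "distinct vs" "set vs = X" for vs \<mu>
  proof -
    have "hs_matrix (cayley_graph G S) vs
        = mat (length vs) (length vs) (\<lambda>(i, j). hs_op (delta (vs ! j)) (vs ! i))"
      unfolding hs_matrix_def
    proof (rule cong_mat)
      fix i j assume "i < length vs" "j < length vs"
      then have "vs ! i \<in> X" "vs ! j \<in> X" using vs(2) by (metis nth_mem)+
      then show "(case (i, j) of (i, j) \<Rightarrow> hs_entry (cayley_graph G S) (vs ! i) (vs ! j))
          = (case (i, j) of (i, j) \<Rightarrow> hs_op (delta (vs ! j)) (vs ! i))"
        by (simp add: hs_entry_eq_coef hs_op_delta)
    qed simp_all
    then show ?thesis
      using enum_eigenvalue[OF vs lin_op_hs] by simp
  qed
  have "pverts (cayley_graph G S) = X" by (simp add: cayley_graph_def)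
  then show ?thesis
    unfolding HS_integral_def using eq finite_distinct_list[OF fin] by metis
qed

text \<open>Multiplication by \<open>\<mu>\<close> sends each value of an eigenvector to a
  combination of its values with coefficients in the ring generated by \<open>omega6\<close>.
  Adjoining the \<open>omega6\<close> multiples of the values makes the coefficients
  integers.\<close>

lemma algebraic_int_hs_eigenvalue:
  assumes "op_eigenvalue X hs_op \<mu>"
  shows "algebraic_int \<mu>"
proof -
  obtain v where v: "v \<in> fun_on X" "v \<noteq> (\<lambda>x. 0)" "hs_op v = (\<lambda>x. \<mu> * v x)"
    using assms unfolding op_eigenvalue_def by blast
  let ?W = "v ` X \<union> (\<lambda>x. omega6 * v x) ` X"
  obtain x where x: "x \<in> X" "v x \<noteq> 0"
    using v(1,2) unfolding fun_on_def fun_eq_iff by blast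
  have base: "v x \<in> int_span ?W" "omega6 * v x \<in> int_span ?W" if "x \<in> X" for x
    using that fin by (auto intro!: int_span_base)
  have diff: "a - b \<in> int_span ?W" if "a \<in> int_span ?W" "b \<in> int_span ?W" for a b
    using int_span_add[OF that(1) int_span_of_int_mult[OF that(2), of "-1"]] by simp
  have c1: "coef t * v x \<in> int_span ?W" if "x \<in> X" for t x
    using base[OF that] diff by (auto simp: coef_def cnj_omega6_eq left_diff_distrib)
  have c2: "coef t * (omega6 * v x) \<in> int_span ?W" if "x \<in> X" for t x
  proof -
    have "cnj omega6 * (omega6 * v x) = v x" "omega6 * (omega6 * v x) = omega6 * v x - v x"
      by (simp_all add: cnj_omega6_eq omega6_square left_diff_distrib flip: mult.assoc)
    then show ?thesis
      using base[OF that] diff unfolding coef_def by (simp only: mult_zero_left int_span_0 split: if_split) blast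
  qed
  have \<mu>: "\<mu> * v x = (\<Sum>t\<in>X. coef t * v (t \<otimes> x))" if "x \<in> X" for x
    using fun_cong[OF v(3), of x] that by (simp add: hs_op_def shift_def)
  show ?thesis
  proof (rule algebraic_int_int_span[of ?W "v x"])
    fix w assume "w \<in> ?W"
    then consider y where "y \<in> X" "w = v y" | y where "y \<in> X" "w = omega6 * v y" by blast
    then show "\<mu> * w \<in> int_span ?W"
    proof cases
      case 1
      then show ?thesis unfolding 1 \<mu>[OF 1(1)] by (intro int_span_sum c1) auto
    next
      case 2
      have "\<mu> * w = omega6 * (\<mu> * v y)" unfolding 2 by simp
      also have "\<dots> = (\<Sum>t\<in>X. coef t * (omega6 * v (t \<otimes> y)))"
        unfolding \<mu>[OF 2(1)] sum_distrib_left by (simp only: mult.left_commute)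
      also have "\<dots> \<in> int_span ?W" using 2 by (intro int_span_sum c2) auto
      finally show ?thesis .
    qed
  qed (use fin x in auto)
qed

text \<open>The translation by \<open>t\<close> is annihilated by x^n - 1, so its eigenvalue on a
  joint eigenvector with \<open>U\<close> is a root of unity.\<close>

lemma joint_eigenvector_shift:
  assumes t: "t \<in> X" "t [^] n = \<one>" and n: "n > 0" and U: "lin_op X U"
    and comm: "\<And>v. v \<in> fun_on X \<Longrightarrow> U (shift G t v) = shift G t (U v)"
    and v: "v \<in> fun_on X" "v \<noteq> (\<lambda>x. 0)" "U v = (\<lambda>x. \<mu> * v x)"
  obtains w \<zeta> where "w \<in> fun_on X" "w \<noteq> (\<lambda>x. 0)" "U w = (\<lambda>x. \<mu> * w x)" "\<zeta> ^ n = 1"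
    "\<And>k. shift G (t [^] (k::nat)) w = (\<lambda>x. \<zeta> ^ k * w x)"
proof -
  let ?T = "shift G t"
  let ?f = "Polynomial.monom 1 n - 1 :: complex poly"
  note T = lin_op_shift[OF t(1)]
  have monom: "poly_op ?T (Polynomial.monom 1 k) v = (?T ^^ k) v" for k
    by (induction k) (simp_all add: poly_op_pCons[OF T] monom_0 monom_Suc lin_op_zero[OF T])
  have "poly_op ?T (Polynomial.monom 1 n + Polynomial.smult (-1) 1) v = (\<lambda>x. v x + -1 * v x)"
    unfolding poly_op_add[OF T v(1)] poly_op_smult[OF T v(1)] monom shift_pow[OF t(1) v(1)] t(2)
      shift_one[OF v(1)]
    by (simp add: poly_op_pCons[OF T] lin_op_zero[OF T] one_pCons)
  moreover have "Polynomial.monom 1 n + Polynomial.smult (-1) 1 = ?f" by (simp add: one_pCons)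
  ultimately have "poly_op ?T ?f v = (\<lambda>x. 0)" by (simp only:) simp
  moreover have "?f \<noteq> 0"
  proof
    assume "?f = 0"
    then have "coeff ?f n = 0" by simp
    then show False using n by simp
  qed
  ultimately obtain w \<zeta> where w: "w \<in> fun_on X" "w \<noteq> (\<lambda>x. 0)" "U w = (\<lambda>x. \<mu> * w x)"
    "?T w = (\<lambda>x. \<zeta> * w x)" "poly ?f \<zeta> = 0"
    using commuting_eigenvector[OF T U comm v] by blast
  have "shift G (t [^] k) w = (\<lambda>x. \<zeta> ^ k * w x)" for k :: nat
  proof (induction k)
    case 0
    then show ?case by (simp add: shift_one w(1))
  next
    case (Suc k)
    have "shift G (t [^] Suc k) w = shift G t (\<lambda>x. \<zeta> ^ k * w x)"
      using t(1) shift_shift[of t "t [^] k" w] Suc by simp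
    then show ?case
      by (simp add: lin_op_smult[OF T w(1)] w(4) mult.assoc mult.left_commute)
  qed
  moreover have "\<zeta> ^ n = 1" using w(5) by (simp add: poly_monom)
  ultimately show ?thesis using that w by blast
qed

subsection \<open>Power-closed connection sets have integral spectrum\<close>

text \<open>Closure under the relation \<open>simeq3\<close>, phrased through exponents;
  \<open>EE_iff\<close> identifies it with membership in \<open>EE G\<close>.\<close>

definition power_closed :: bool where
  "power_closed \<longleftrightarrow> (\<forall>t\<in>S. \<forall>k::int. coprime k (int (ord t)) \<and> [k = 1] (mod 3) \<longrightarrow> t [^] k \<in> S)"

lemma int_pow_cong:
  assumes "x \<in> X" "[i = j] (mod int (ord x))"
  shows "x [^] (i :: int) = x [^] j"
  using assms int_pow_eq by (metis cong_iff_dvd_diff cong_sym)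

lemma ord_int_pow_coprime:
  assumes x: "x \<in> X" and k: "coprime k (int (ord x))"
  shows "ord (x [^] k) = ord x"
proof -
  have pos: "ord x > 0" using ord_ge_1[OF fin x] by simp
  define j where "j = nat (k mod int (ord x))"
  have j: "int j = k mod int (ord x)" using pos by (simp add: j_def)
  then have "coprime (int j) (int (ord x))"
    using k pos by (simp add: coprime_mod_left_iff)
  then have "coprime j (ord x)" by simp
  moreover have "x [^] k = x [^] int j"
    by (rule int_pow_cong[OF x]) (simp add: j cong_def)
  ultimately show ?thesis
    using pow_ord_eq_ord_iff[OF fin x, of j] by (simp add: int_pow_int)
qed

text \<open>If 3 did not divide the order, some exponent would be 1 modulo 3 and -1 modulo the
  order, and \<open>inv t\<close> would lie in \<open>S\<close> against skewness.\<close>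

lemma power_closed_imp_Gamma3:
  assumes Q: power_closed and t: "t \<in> S"
  shows "3 dvd ord t"
proof (rule ccontr)
  assume "\<not> 3 dvd ord t"
  then have "coprime 3 (ord t)"
    by (intro prime_imp_coprime) simp_all
  then have "coprime (3 :: int) (int (ord t))"
    by (metis coprime_int_iff of_nat_numeral)
  then obtain k where k: "[k = 1] (mod 3)" "[k = -1] (mod int (ord t))"
    using binary_chinese_remainder_int by blast
  have tX: "t \<in> X" using t sub by blast
  have "coprime k (int (ord t))"
    using cong_imp_coprime[OF cong_sym[OF k(2)]] by simp
  then have "t [^] k \<in> S" using Q k(1) t unfolding power_closed_def by blast
  moreover have "t [^] k = inv t"
    using int_pow_cong[OF tX k(2)] tX by (simp add: int_pow_neg)
  ultimately show False using skew[OF t] by simp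
qed

text \<open>Forwards, exponents multiply and coprime powers keep the order. Backwards,
  \<open>S\<close> serves as its own set of representatives.\<close>

lemma EE_iff: "S \<in> EE G \<longleftrightarrow> power_closed"
proof
  assume "S \<in> EE G"
  then obtain Y where Y: "Y \<subseteq> Gamma3 G" "S = (\<Union>x\<in>Y. class3 G x)"
    unfolding EE_def by blast
  show power_closed
    unfolding power_closed_def
  proof (intro ballI allI impI)
    fix t and k :: int assume t: "t \<in> S" and k: "coprime k (int (ord t)) \<and> [k = 1] (mod 3)"
    obtain x where x: "x \<in> Y" "t \<in> class3 G x" using t Y(2) by blast
    then obtain j :: int where j: "coprime j (int (ord x))" "[j = 1] (mod 3)" "t = x [^] j"
      unfolding class3_def simeq3_def by blast
    have xX: "x \<in> X" and tX: "t \<in> X" using x Y(1) t sub unfolding Gamma3_def by auto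
    have ord: "ord t = ord x" using ord_int_pow_coprime[OF xX j(1)] j(3) by simp
    have "[j * k = 1] (mod 3)" using cong_mult[OF j(2), of k 1] k by simp
    moreover have "coprime (j * k) (int (ord x))" using j(1) k ord by simp
    moreover have "t [^] k = x [^] (j * k)" using j(3) xX by (simp add: int_pow_pow)
    ultimately have "simeq3 G x (t [^] k)" unfolding simeq3_def by blast
    moreover have "t [^] k \<in> Gamma3 G"
      using ord_int_pow_coprime[OF tX] k x(2) tX unfolding class3_def Gamma3_def by simp
    ultimately show "t [^] k \<in> S" using x(1) Y(2) unfolding class3_def by blast
  qed
next
  assume Q: power_closed
  have G3: "S \<subseteq> Gamma3 G"
    using power_closed_imp_Gamma3[OF Q] sub unfolding Gamma3_def by blast
  have "x \<in> class3 G x" if "x \<in> S" for x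
  proof -
    have "simeq3 G x x"
      unfolding simeq3_def using that sub by (intro exI[of _ 1]) (auto simp: int_pow_1)
    then show ?thesis using that G3 unfolding class3_def by blast
  qed
  moreover have "class3 G x \<subseteq> S" if "x \<in> S" for x
    using Q that unfolding class3_def simeq3_def power_closed_def by blast
  ultimately have "S = (\<Union>x\<in>S. class3 G x)" by blast
  moreover have "skew_symmetric G S"
    using sub skew unfolding skew_symmetric_def by blast
  ultimately show "S \<in> EE G"
    using G3 finite_subset[OF sub fin] unfolding EE_def by blast
qed

section \<open>Power maps with exponent prime to the group order\<close>

abbreviation "N \<equiv> card X"

lemma N_pos: "N > 0"
  using fin one_closed by (auto simp: card_gt_0_iff)

lemma ord_dvd_N: "t \<in> X \<Longrightarrow> ord t dvd N"
  using ord_dvd_group_order[of t] by (simp add: Coset.order_def)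

lemma pow_multiple_N: "t \<in> X \<Longrightarrow> t [^] (3 * N) = \<one>"
  using ord_dvd_N pow_eq_id by (simp add: dvd_mult)

text \<open>An inverse of \<open>k\<close> modulo \<open>3 * N\<close> is again coprime to the
  modulus and 1 modulo 3, so the power map can be undone inside \<open>S\<close>.\<close>

lemma power_closed_iff_pow:
  assumes Q: power_closed and t: "t \<in> X" and k: "coprime k (int (3 * N))" "[k = 1] (mod 3)"
  shows "t [^] k \<in> S \<longleftrightarrow> t \<in> S"
proof
  have cop: "coprime l (int (ord s))" if "coprime l (int (3 * N))" "s \<in> X" for l s
    using that ord_dvd_N[OF that(2)] by (meson coprime_divisors dvd_mult dvd_refl of_nat_dvd_iff)
  show "t [^] k \<in> S" if "t \<in> S"
    using Q that cop[OF k(1) t] k(2) unfolding power_closed_def by blast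
  assume tk: "t [^] k \<in> S"
  obtain l where l: "[k * l = 1] (mod int (3 * N))"
    using cong_solve_coprime_int[OF k(1)] by blast
  have "coprime (k * l) (int (3 * N))"
    using cong_imp_coprime[OF cong_sym[OF l]] by simp
  then have cl: "coprime l (int (3 * N))" by simp
  have "[k * l = 1] (mod 3)"
    using l by (rule cong_dvd_modulus) simp
  moreover have "[k * l = 1 * l] (mod 3)"
    by (rule cong_mult[OF k(2) cong_refl])
  ultimately have "[l = 1] (mod 3)"
    by (metis cong_sym cong_trans mult_1)
  then have "(t [^] k) [^] l \<in> S"
    using Q tk cop[OF cl] t unfolding power_closed_def by simp
  moreover have "(t [^] k) [^] l = t [^] (1::int)"
    unfolding int_pow_pow[OF t]
    by (rule int_pow_cong[OF t], rule cong_dvd_modulus[OF l])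
       (use ord_dvd_N[OF t] in \<open>simp add: dvd_mult\<close>)
  ultimately show "t \<in> S" using t by (simp add: int_pow_1)
qed

text \<open>If \<open>k\<close> is 1 modulo 3, membership of \<open>t\<close> and of
  \<open>inv t\<close> in \<open>S\<close> is preserved. If it is 2, then \<open>- k\<close> is 1
  modulo 3, so the two memberships are exchanged, which conjugates the coefficient.\<close>

lemma coef_pow:
  assumes Q: power_closed and t: "t \<in> X" and k: "coprime k (3 * N)"
  shows "coef (t [^] k) = gal k (coef t)"
proof -
  have ck: "coprime (int k) (int (3 * N))" using k by (simp only: coprime_int_iff)
  have "coprime k 3" using k by simp
  then have "\<not> 3 dvd k" by (metis coprime_absorb_right nat_dvd_1_iff_1 numeral_eq_one_iff semiring_norm(86))
  then consider "k mod 3 = 1" | "k mod 3 = 2" using not_dvd_3_cases by blast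
  then show ?thesis
  proof cases
    case 1
    have "int k mod 3 = 1" using 1 by (metis of_nat_mod of_nat_numeral of_nat_1)
    then have k3: "[int k = 1] (mod 3)" by (simp add: cong_def)
    have "t [^] k \<in> S \<longleftrightarrow> t \<in> S" "inv (t [^] k) \<in> S \<longleftrightarrow> inv t \<in> S"
      using power_closed_iff_pow[OF Q t ck k3] power_closed_iff_pow[OF Q inv_closed[OF t] ck k3] t
      by (simp_all add: int_pow_int nat_pow_inv)
    then show ?thesis using 1 by (simp add: coef_def gal_def)
  next
    case 2
    have "int k mod 3 = 2" using 2 by (metis of_nat_mod of_nat_numeral)
    then have "(- int k) mod 3 = 1 mod 3" by presburger
    then have k3: "[- int k = 1] (mod 3)" by (simp add: cong_def)
    have ck': "coprime (- int k) (int (3 * N))" using ck by simp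
    have "inv (t [^] k) \<in> S \<longleftrightarrow> t \<in> S" "t [^] k \<in> S \<longleftrightarrow> inv t \<in> S"
      using power_closed_iff_pow[OF Q t ck' k3] power_closed_iff_pow[OF Q inv_closed[OF t] ck' k3] t
      by (simp_all add: int_pow_int int_pow_neg nat_pow_inv)
    then show ?thesis using 2 skew by (auto simp: coef_def gal_def)
  qed
qed

lemma bij_betw_pow:
  assumes "coprime k N"
  shows "bij_betw (\<lambda>t. t [^] (k::nat)) X X"
proof -
  obtain l where l: "[k * l = 1] (mod N)"
    using cong_solve_coprime_nat[OF assms] by auto
  have "(t [^] k) [^] l = t" if t: "t \<in> X" for t
  proof -
    have "[int (k * l) = 1] (mod int N)" using l by (metis cong_int_iff of_nat_1)
    then have "[int (k * l) = 1] (mod int (ord t))"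
      by (rule cong_dvd_modulus) (use ord_dvd_N[OF t] in auto)
    then have "t [^] int (k * l) = t [^] (1::int)" by (rule int_pow_cong[OF t])
    then show ?thesis using t by (simp only: nat_pow_pow int_pow_int int_pow_1)
  qed
  then have "inj_on (\<lambda>t. t [^] k) X"
    by (rule inj_on_inverseI)
  moreover from this have "(\<lambda>t. t [^] k) ` X = X"
    by (intro endo_inj_surj fin) auto
  ultimately show ?thesis unfolding bij_betw_def by blast
qed

text \<open>For a value \<open>c\<close> of the coefficient function, \<open>gal k c = - (- c)\<^sup>k\<close>, so \<open>U\<close> below acts on
  a \<open>\<zeta>\<close>-eigenvector of the shift by \<open>t\<close> as minus the Ramanujan sum of \<open>- c \<zeta>\<close>.\<close>

lemma galois_orbit_trace_Ints:
  assumes E: "lin_op X E" and idem: "\<And>v. v \<in> fun_on X \<Longrightarrow> E (E v) = E v"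
    and comm: "\<And>s v. s \<in> X \<Longrightarrow> v \<in> fun_on X \<Longrightarrow> shift G s (E v) = E (shift G s v)"
    and t: "t \<in> X" and c: "c \<in> hs_values"
  shows "(\<Sum>k\<in>totatives (3 * N). gal k c * op_trace X (\<lambda>v. shift G (t [^] k) (E v))) \<in> \<int>"
proof (cases "c = 0")
  case True
  then show ?thesis by (simp add: gal_def)
next
  case False
  let ?n = "3 * N"
  define U where "U v u = (\<Sum>k\<in>totatives ?n. gal k c * shift G (t [^] k) v u)" for v u
  have U: "lin_op X U"
    unfolding U_def[abs_def] by (intro lin_op_lincomb lin_op_shift) (use t in simp)
  have T_in: "shift G (t [^] k) v \<in> fun_on X" if "v \<in> fun_on X" for k :: nat and v
    by (rule lin_op_closed[OF lin_op_shift that]) (use t in simp)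
  have UE: "U (E v) = E (U v)" if v: "v \<in> fun_on X" for v
    unfolding U_def by (subst lin_op_sum[OF E]) (use t v comm T_in in auto)
  have US: "U (shift G t v) = shift G t (U v)" if v: "v \<in> fun_on X" for v
  proof -
    have "shift G (t [^] k) (shift G t v) = shift G t (shift G (t [^] k) v)" for k :: nat
      using t by (simp add: shift_shift) (metis nat_pow_Suc nat_pow_Suc2)
    then show ?thesis
      unfolding U_def by (subst lin_op_sum[OF lin_op_shift[OF t]]) (use v T_in in auto)
  qed
  have "op_trace X (\<lambda>v. U (E v)) \<in> \<int>"
  proof (rule op_trace_Ints[OF fin lin_op_compose[OF U E]])
    fix \<mu> assume ev: "op_eigenvalue X (\<lambda>v. U (E v)) \<mu>"
    show "\<mu> \<in> \<int>"
    proof (cases "\<mu> = 0")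
      case False
      \<comment> \<open>A nonzero eigenvalue of the composition is an eigenvalue of
        \<open>U\<close>, so the projection drops out.\<close>
      obtain v where v: "v \<in> fun_on X" "v \<noteq> (\<lambda>x. 0)" "U v = (\<lambda>x. \<mu> * v x)"
        using op_eigenvalue_compose_idempotent[OF U E idem UE ev False] by metis
      obtain w \<zeta> where w: "w \<in> fun_on X" "w \<noteq> (\<lambda>x. 0)" "U w = (\<lambda>x. \<mu> * w x)" "\<zeta> ^ ?n = 1"
        "\<And>k. shift G (t [^] (k::nat)) w = (\<lambda>x. \<zeta> ^ k * w x)"
        using joint_eigenvector_shift[OF t pow_multiple_N[OF t] _ U US v] N_pos by auto
      obtain x where x: "w x \<noteq> 0" using w(2) by auto
      have "\<mu> * w x = (\<Sum>k\<in>totatives ?n. gal k c * \<zeta> ^ k) * w x"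
        using fun_cong[OF w(3), of x] by (simp add: U_def w(5) sum_distrib_right mult.assoc)
      then have "\<mu> = (\<Sum>k\<in>totatives ?n. gal k c * \<zeta> ^ k)" using x by simp
      also have "\<dots> = (\<Sum>k\<in>totatives ?n. - ((- c * \<zeta>) ^ k))"
      proof (rule sum.cong)
        fix k assume "k \<in> totatives ?n"
        then have "coprime k 3" by (simp add: in_totatives_iff)
        then have "\<not> 3 dvd k"
          by (metis coprime_absorb_right nat_dvd_1_iff_1 numeral_eq_one_iff semiring_norm(86))
        then show "gal k c * \<zeta> ^ k = - ((- c * \<zeta>) ^ k)"
          by (subst gal_eq_power[OF c]) (simp_all add: power_mult_distrib flip: mult_minus_left)
      qed simp
      also have "\<dots> = - (\<Sum>k\<in>totatives ?n. (- c * \<zeta>) ^ k)" by (rule sum_negf)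
      also have "\<dots> \<in> \<int>"
      proof -
        \<comment> \<open>The factor 3 in the modulus absorbs the cube root of unity
          \<open>- c\<close>.\<close>
        have "(- c * \<zeta>) ^ ?n = ((- c) ^ 3) ^ N * \<zeta> ^ ?n"
          by (simp only: power_mult_distrib power_mult)
        also have "\<dots> = 1"
          by (simp only: neg_cube_hs_values[OF c \<open>c \<noteq> 0\<close>] w(4) power_one mult_1)
        finally show ?thesis
          using ramanujan_sum_Ints[of ?n "- c * \<zeta>"] N_pos by (intro Ints_minus) auto
      qed
      finally show ?thesis .
    qed simp
  qed
  then show ?thesis
    unfolding U_def op_trace_lincomb .
qed

text \<open>Power maps prime to \<open>3 * N\<close> permute the group, so the trace of
  \<open>hs_op\<close> on the range of \<open>E\<close> may be summed over all of them; each
  resulting Galois orbit sum is an integer. Hence \<open>\<mu>\<close> is a quotient of integers,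
  and it is an algebraic integer.\<close>

lemma power_closed_imp_HS_integral:
  assumes Q: power_closed and ev: "op_eigenvalue X hs_op \<mu>"
  shows "\<mu> \<in> \<int>"
proof -
  obtain E where E: "lin_op X E" "\<And>v. v \<in> fun_on X \<Longrightarrow> E (E v) = E v"
    and comm: "\<And>U v. lin_op X U \<Longrightarrow> (\<And>v. v \<in> fun_on X \<Longrightarrow> U (hs_op v) = hs_op (U v)) \<Longrightarrow>
      v \<in> fun_on X \<Longrightarrow> U (E v) = E (U v)"
    and tr: "op_trace X E \<in> \<int>" "op_trace X E \<noteq> 0"
      "op_trace X (\<lambda>v. hs_op (E v)) = \<mu> * op_trace X E"
    using spectral_projection_trace[OF lin_op_hs fin ev] by blast
  have comm': "shift G s (E v) = E (shift G s v)" if "s \<in> X" "v \<in> fun_on X" for s v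
    by (rule comm[OF lin_op_shift[OF that(1)] _ that(2)]) (simp add: hs_op_shift[OF that(1)])
  define \<theta> where "\<theta> s = op_trace X (\<lambda>v. shift G s (E v))" for s
  let ?n = "3 * N"
  \<comment> \<open>The summand does not yet depend on \<open>k\<close>; \<open>totient\<close>
    counts the copies.\<close>
  have "of_nat (totient ?n) * (\<mu> * op_trace X E) = (\<Sum>k\<in>totatives ?n. \<Sum>t\<in>X. coef t * \<theta> t)"
    unfolding tr(3)[symmetric] hs_op_def op_trace_lincomb \<theta>_def by (simp add: totient_def)
  also have "\<dots> = (\<Sum>k\<in>totatives ?n. \<Sum>t\<in>X. coef (t [^] k) * \<theta> (t [^] k))"
  proof (rule sum.cong)
    fix k assume "k \<in> totatives ?n"
    then have "coprime k N" by (simp add: in_totatives_iff)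
    then show "(\<Sum>t\<in>X. coef t * \<theta> t) = (\<Sum>t\<in>X. coef (t [^] k) * \<theta> (t [^] k))"
      using sum.reindex_bij_betw[OF bij_betw_pow, of k "\<lambda>t. coef t * \<theta> t"] by simp
  qed simp
  also have "\<dots> = (\<Sum>t\<in>X. \<Sum>k\<in>totatives ?n. gal k (coef t) * \<theta> (t [^] k))"
    by (subst sum.swap) (simp add: coef_pow[OF Q] in_totatives_iff)
  also have "\<dots> \<in> \<int>"
    unfolding \<theta>_def by (intro Ints_sum galois_orbit_trace_Ints E comm' coef_values)
  finally have int: "of_nat (totient ?n) * (\<mu> * op_trace X E) \<in> \<int>" .
  define d where "d = of_nat (totient ?n) * op_trace X E"
  have d: "d \<in> \<int>" "d \<noteq> 0"
    using tr(1,2) N_pos by (auto simp: d_def)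
  have "\<mu> = of_nat (totient ?n) * (\<mu> * op_trace X E) / d"
    using d(2) by (auto simp: d_def)
  then have "\<mu> \<in> \<rat>"
    using int d(1) by (metis Ints_subset_Rats Rats_divide subsetD)
  then show ?thesis
    using algebraic_int_hs_eigenvalue[OF ev] by (intro algebraic_int_Rats_imp_Ints)
qed

subsection \<open>Integral spectrum forces power-closedness\<close>

abbreviation "root_n \<equiv> cis (2 * pi / real (3 * N))"

text \<open>For \<open>s\<close> in the group, the projection onto the eigenspace of
  \<open>shift G s\<close> for the eigenvalue \<open>root_n ^ j\<close>.\<close>

definition fourier_op :: "'a \<Rightarrow> nat \<Rightarrow> ('a \<Rightarrow> complex) \<Rightarrow> 'a \<Rightarrow> complex" where
  "fourier_op s j v = (\<lambda>u. \<Sum>i<3 * N. (cnj root_n ^ (j * i) / of_nat (3 * N)) * shift G (s [^] i) v u)"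

lemma root_n_power: "root_n ^ (3 * N) = 1"
  using N_pos by (simp add: DeMoivre)

lemma root_n_cnj: "root_n * cnj root_n = 1"
  by (simp add: cis_cnj cis_mult)

lemma root_n_inj:
  assumes "i < 3 * N" "k < 3 * N" "root_n ^ i = root_n ^ k"
  shows "i = k"
proof -
  have "inj_on (\<lambda>k. cis (2 * pi * real k / real (3 * N))) {..<3 * N}"
    using bij_betw_roots_unity[of "3 * N"] N_pos by (simp add: bij_betw_def)
  moreover have "root_n ^ k = cis (2 * pi * real k / real (3 * N))" for k
    by (simp add: DeMoivre mult_ac)
  ultimately show ?thesis using assms by (auto dest: inj_onD)
qed

text \<open>On a joint eigenvector with the translation the projection acts as 1 or 0, so each
  eigenvalue of the composition is an eigenvalue of \<open>hs_op\<close> or 0.\<close>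

lemma op_trace_fourier_Ints:
  assumes int: "\<And>\<mu>. op_eigenvalue X hs_op \<mu> \<Longrightarrow> \<mu> \<in> \<int>" and s: "s \<in> X"
  shows "op_trace X (\<lambda>v. hs_op (fourier_op s j v)) \<in> \<int>"
proof (rule op_trace_Ints[OF fin])
  let ?n = "3 * N"
  let ?F = "fourier_op s j"
  have F: "lin_op X ?F"
    unfolding fourier_op_def[abs_def] by (intro lin_op_lincomb lin_op_shift) (use s in simp)
  show HF: "lin_op X (\<lambda>v. hs_op (?F v))" by (rule lin_op_compose[OF lin_op_hs F])
  have T_in: "shift G (s [^] i) v \<in> fun_on X" if "v \<in> fun_on X" for i :: nat and v
    by (rule lin_op_closed[OF lin_op_shift that]) (use s in simp)
  have FS: "?F (shift G s v) = shift G s (?F v)" if v: "v \<in> fun_on X" for v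
  proof -
    have "shift G (s [^] i) (shift G s v) = shift G s (shift G (s [^] i) v)" for i :: nat
      using s by (simp add: shift_shift) (metis nat_pow_Suc nat_pow_Suc2)
    then show ?thesis
      unfolding fourier_op_def by (subst lin_op_sum[OF lin_op_shift[OF s]]) (use v T_in in auto)
  qed
  fix \<mu> assume "op_eigenvalue X (\<lambda>v. hs_op (?F v)) \<mu>"
  then obtain v where v: "v \<in> fun_on X" "v \<noteq> (\<lambda>x. 0)" "hs_op (?F v) = (\<lambda>x. \<mu> * v x)"
    unfolding op_eigenvalue_def by blast
  obtain w \<zeta> where w: "w \<in> fun_on X" "w \<noteq> (\<lambda>x. 0)" "hs_op (?F w) = (\<lambda>x. \<mu> * w x)"
    "\<zeta> ^ ?n = 1" "\<And>i. shift G (s [^] (i::nat)) w = (\<lambda>x. \<zeta> ^ i * w x)"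
    using joint_eigenvector_shift[OF s pow_multiple_N[OF s] _ HF _ v] N_pos
    by (auto simp: FS hs_op_shift[OF s])
  define \<eta> where "\<eta> = cnj root_n ^ j * \<zeta>"
  have "\<eta> ^ ?n = cnj (root_n ^ ?n) ^ j * \<zeta> ^ ?n"
    unfolding \<eta>_def power_mult_distrib complex_cnj_power by (simp only: power_mult[symmetric] mult.commute)
  then have "\<eta> ^ ?n = 1" by (simp only: root_n_power w(4)) simp
  then have geo: "(\<Sum>i<?n. \<eta> ^ i) = (if \<eta> = 1 then of_nat ?n else 0)"
    by (rule geometric_sum_unity)
  have "?F w = (\<lambda>x. (\<Sum>i<?n. \<eta> ^ i) / of_nat ?n * w x)"
    by (simp add: fourier_op_def w(5) \<eta>_def power_mult_distrib power_mult sum_distrib_right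
        sum_divide_distrib mult.assoc del: of_nat_mult)
  then consider "?F w = w" | "?F w = (\<lambda>x. 0)"
    using N_pos unfolding geo by (cases "\<eta> = 1") auto
  then show "\<mu> \<in> \<int>"
  proof cases
    case 1
    then have "op_eigenvalue X hs_op \<mu>"
      using w(1-3) unfolding op_eigenvalue_def by auto
    then show ?thesis by (rule int)
  next
    case 2
    then have "(\<lambda>x. \<mu> * w x) = (\<lambda>x. 0)"
      using w(3) lin_op_zero[OF lin_op_hs] by simp
    then have "\<mu> = 0" using w(2) by (auto simp: fun_eq_iff)
    then show ?thesis by simp
  qed
qed

text \<open>The integers \<open>b j\<close> are the traces of \<open>hs_op\<close> composed with the
  projections for \<open>inv t\<close>; the inverse is taken because
  \<open>op_trace_hs_shift\<close> inverts its argument. They are the discrete Fourier transform of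
  the coefficients along powers of \<open>t\<close>.\<close>

lemma coef_fourier_expansion:
  assumes int: "\<And>\<mu>. op_eigenvalue X hs_op \<mu> \<Longrightarrow> \<mu> \<in> \<int>" and t: "t \<in> X"
  obtains b :: "nat \<Rightarrow> int" where
    "\<And>k::nat. of_nat N * coef (t [^] k) = (\<Sum>j<3 * N. of_int (b j) * root_n ^ (j * k))"
proof -
  let ?n = "3 * N"
  define f where "f i = of_nat N * coef (t [^] (i::nat))" for i
  have tr: "op_trace X (\<lambda>v. hs_op (fourier_op (inv t) j v))
      = (\<Sum>i<?n. (cnj root_n ^ (j * i) / of_nat ?n) * f i)" for j
  proof -
    have tX: "inv t [^] i \<in> X" for i :: nat using t by simp
    have "op_trace X (\<lambda>v. hs_op (fourier_op (inv t) j v))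
        = op_trace X (\<lambda>v u. \<Sum>i<?n. (cnj root_n ^ (j * i) / of_nat ?n) * hs_op (shift G (inv t [^] i) v) u)"
      unfolding op_trace_def fourier_op_def
      by (intro sum.cong refl, subst lin_op_sum[OF lin_op_hs])
         (auto intro!: lin_op_closed[OF lin_op_shift[OF tX]])
    also have "\<dots> = (\<Sum>i<?n. (cnj root_n ^ (j * i) / of_nat ?n) * f i)"
      unfolding op_trace_lincomb op_trace_hs_shift[OF tX] f_def using t by (simp add: nat_pow_inv)
    finally show ?thesis .
  qed
  have "\<exists>b. op_trace X (\<lambda>v. hs_op (fourier_op (inv t) j v)) = of_int b" for j
    using op_trace_fourier_Ints[OF int inv_closed[OF t], of j] by (auto elim: Ints_cases)
  then obtain b :: "nat \<Rightarrow> int" where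
    b: "\<And>j. (\<Sum>i<?n. (cnj root_n ^ (j * i) / of_nat ?n) * f i) = of_int (b j)"
    unfolding tr by metis
  \<comment> \<open>Fourier inversion on one period, by orthogonality of the powers of
    \<open>root_n\<close>.\<close>
  have small: "f k = (\<Sum>j<?n. of_int (b j) * root_n ^ (j * k))" if k: "k < ?n" for k
  proof -
    have orth: "(\<Sum>j<?n. cnj root_n ^ (j * i) * root_n ^ (j * k)) = (if i = k then of_nat ?n else 0)"
      if i: "i < ?n" for i
    proof -
      define \<eta> where "\<eta> = cnj root_n ^ i * root_n ^ k"
      have "\<eta> ^ ?n = cnj (root_n ^ ?n) ^ i * (root_n ^ ?n) ^ k"
        unfolding \<eta>_def power_mult_distrib complex_cnj_power by (simp only: power_mult[symmetric] mult.commute)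
      then have "\<eta> ^ ?n = 1" by (simp only: root_n_power) simp
      moreover have "\<eta> = 1 \<longleftrightarrow> i = k"
      proof
        assume "\<eta> = 1"
        then have "root_n ^ i * (cnj root_n ^ i * root_n ^ k) = root_n ^ i" by (simp add: \<eta>_def)
        then have "(root_n * cnj root_n) ^ i * root_n ^ k = root_n ^ i"
          by (simp only: power_mult_distrib mult.assoc)
        then show "i = k"
          using root_n_inj[OF i k] unfolding root_n_cnj by simp
      next
        assume "i = k"
        then have "\<eta> = (root_n * cnj root_n) ^ k" by (simp only: \<eta>_def power_mult_distrib mult.commute)
        then show "\<eta> = 1" unfolding root_n_cnj by simp
      qed
      moreover have "(\<Sum>j<?n. cnj root_n ^ (j * i) * root_n ^ (j * k)) = (\<Sum>j<?n. \<eta> ^ j)"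
        unfolding \<eta>_def by (simp add: power_mult_distrib power_mult mult.commute[of _ i] mult.commute[of _ k])
      ultimately show ?thesis using geometric_sum_unity[of \<eta> ?n] by simp
    qed
    have "(\<Sum>j<?n. of_int (b j) * root_n ^ (j * k))
        = (\<Sum>j<?n. \<Sum>i<?n. (f i / of_nat ?n) * (cnj root_n ^ (j * i) * root_n ^ (j * k)))"
      unfolding b[symmetric] sum_distrib_right by (simp add: mult_ac)
    also have "\<dots> = (\<Sum>i<?n. (f i / of_nat ?n) * (\<Sum>j<?n. cnj root_n ^ (j * i) * root_n ^ (j * k)))"
      by (subst sum.swap) (simp only: sum_distrib_left)
    also have "\<dots> = (\<Sum>i<?n. (f i / of_nat ?n) * (if i = k then of_nat ?n else 0))"
      using orth by (intro sum.cong) simp_all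
    also have "\<dots> = f k"
      using k N_pos by (simp add: if_distrib cong: if_cong)
    finally show ?thesis by simp
  qed
  \<comment> \<open>Both sides have period \<open>3 * N\<close> in \<open>k\<close>, which extends
    the formula to all exponents.\<close>
  have "f k = (\<Sum>j<?n. of_int (b j) * root_n ^ (j * k))" for k
  proof -
    have "t [^] k = t [^] (k mod ?n)"
      using pow_multiple_N[OF t] t
      by (metis (no_types, lifting) mod_mult_div_eq mult.commute nat_pow_mult nat_pow_one nat_pow_pow nat_pow_closed r_one)
    then have "f k = f (k mod ?n)" by (simp add: f_def)
    also have "\<dots> = (\<Sum>j<?n. of_int (b j) * root_n ^ (j * (k mod ?n)))"
      using small[of "k mod ?n"] N_pos by simp
    also have "\<dots> = (\<Sum>j<?n. of_int (b j) * root_n ^ (j * k))"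
    proof (rule sum.cong)
      fix j
      have "root_n ^ (j * (k mod ?n)) = (root_n ^ (k mod ?n)) ^ j"
        by (simp only: power_mult[symmetric] mult.commute)
      also have "\<dots> = root_n ^ (j * k)"
        unfolding power_mod_unity[OF root_n_power] by (simp only: power_mult[symmetric] mult.commute)
      finally show "of_int (b j) * root_n ^ (j * (k mod ?n)) = of_int (b j) * root_n ^ (j * k)" by simp
    qed simp
    finally show ?thesis .
  qed
  then show ?thesis using that unfolding f_def by blast
qed

text \<open>The \<open>N\<close>th power of \<open>root_n\<close> is the primitive cube root of
  unity \<open>omega6 - 1\<close>.\<close>

lemma omega6_int_adjoin: "omega6 \<in> int_adjoin root_n"
proof -
  have "root_n ^ N = cis (2 * pi / 3)"
    using N_pos by (simp add: DeMoivre)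
  also have "\<dots> = omega6 - 1"
    by (simp add: omega6_def complex_eq_iff cos_120 sin_120)
  finally have "omega6 = root_n ^ N + of_int 1" by simp
  then show ?thesis by (metis int_adjoin.gen int_adjoin.of_int int_adjoin_add int_adjoin_power)
qed

lemma hs_values_int_adjoin: "x \<in> hs_values \<Longrightarrow> x \<in> int_adjoin root_n"
  using omega6_int_adjoin int_adjoin_cnj[OF omega6_int_adjoin root_n_power] N_pos
    int_adjoin.of_int[of 0]
  by auto

lemma gal_values: "x \<in> hs_values \<Longrightarrow> gal k x \<in> hs_values"
  by (elim insertE emptyE) (simp_all add: gal_def)

text \<open>Frobenius: the two sides agree up to \<open>p\<close> times a cyclotomic integer \<open>\<gamma>\<close> whose norm is
  rational and, for large \<open>p\<close>, smaller than one.\<close>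

lemma coef_pow_large_prime:
  assumes int: "\<And>\<mu>. op_eigenvalue X hs_op \<mu> \<Longrightarrow> \<mu> \<in> \<int>" and t: "t \<in> X"
    and p: "prime p" "p > 2 * N + 3"
  shows "coef (t [^] p) = gal p (coef t)"
proof -
  let ?R = "int_adjoin root_n"
  obtain b :: "nat \<Rightarrow> int" where
    b: "\<And>k::nat. of_nat N * coef (t [^] k) = (\<Sum>j<3 * N. of_int (b j) * root_n ^ (j * k))"
    using coef_fourier_expansion[OF int t] by blast
  have pp: "of_nat p \<noteq> (0 :: complex)" using p by simp
  obtain r where r: "r \<in> ?R" "(\<Sum>j<3 * N. of_int (b j) * root_n ^ j) ^ p
      = (\<Sum>j<3 * N. (of_int (b j) * root_n ^ j) ^ p) + of_nat p * r"
    using int_adjoin_frobenius[OF p(1), of "{..<3 * N}" "\<lambda>j. of_int (b j) * root_n ^ j" root_n]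
      int_adjoin_mult[OF int_adjoin.of_int int_adjoin_power[OF int_adjoin.gen]]
    by blast
  obtain l where l: "\<And>k. (of_int k :: complex) ^ p = of_int k + of_nat p * of_int (l k)"
    using fermat_of_int[OF p(1)] by metis
  have "(\<Sum>j<3 * N. (of_int (b j) * root_n ^ j) ^ p)
      = (\<Sum>j<3 * N. of_int (b j) * root_n ^ (j * p)) + of_nat p * (\<Sum>j<3 * N. of_int (l (b j)) * root_n ^ (j * p))"
    by (simp add: power_mult_distrib l power_mult sum.distrib sum_distrib_left algebra_simps)
  moreover have "(\<Sum>j<3 * N. of_int (b j) * root_n ^ j) = of_nat N * coef t"
    using b[of 1] t by simp
  moreover have "(of_nat N :: complex) ^ p = of_nat N + of_nat p * of_int (l (int N))"
    using l[of "int N"] by simp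
  \<comment> \<open>This is the expansion at exponent 1 raised to the power \<open>p\<close>:
    Frobenius and Fermat turn its right side into the expansion at exponent \<open>p\<close>, up to
    multiples of \<open>p\<close>.\<close>
  ultimately have eq: "(of_nat N + of_nat p * of_int (l (int N))) * coef t ^ p
      = of_nat N * coef (t [^] p) + of_nat p * (\<Sum>j<3 * N. of_int (l (b j)) * root_n ^ (j * p)) + of_nat p * r"
    using r(2) unfolding b[of p] by (simp add: power_mult_distrib)
  \<comment> \<open>All multiples of \<open>p\<close> in \<open>eq\<close>, collected and divided by
    \<open>p\<close>.\<close>
  define \<gamma> where "\<gamma> = (\<Sum>j<3 * N. of_int (l (b j)) * root_n ^ (j * p)) + r - of_int (l (int N)) * coef t ^ p"
  have \<gamma>: "\<gamma> \<in> ?R"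
    unfolding \<gamma>_def using r(1) hs_values_int_adjoin[OF coef_values]
    by (intro int_adjoin_diff int_adjoin_add int_adjoin_sum int_adjoin_mult int_adjoin_power) auto
  have p3: "\<not> 3 dvd p"
    using p primes_dvd_imp_eq[of 3 p] by auto
  \<comment> \<open>For odd \<open>p\<close> the two signs in \<open>gal_eq_power\<close>
    cancel.\<close>
  have "odd p" using p prime_odd_nat by simp
  then have "coef t ^ p = gal p (coef t)"
    by (subst gal_eq_power[OF coef_values p3]) simp
  then have diff: "of_nat p * \<gamma> = of_nat N * (gal p (coef t) - coef (t [^] p))"
    using eq by (simp add: \<gamma>_def algebra_simps)
  define d where "d = gal p (coef t) - coef (t [^] p)"
  have d: "(cmod d)\<^sup>2 \<in> {0, 1, 3}"
    unfolding d_def by (intro hs_values_diff_norm gal_values coef_values)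
  have norm: "real p ^ 2 * (cmod \<gamma>)\<^sup>2 = real N ^ 2 * (cmod d)\<^sup>2"
    using arg_cong[OF diff, of "\<lambda>z. (cmod z)\<^sup>2"] by (simp add: d_def norm_mult power_mult_distrib)
  then have g: "(cmod \<gamma>)\<^sup>2 = real N ^ 2 * (cmod d)\<^sup>2 / real p ^ 2"
    using p by (simp add: field_simps)
  have "(cmod d)\<^sup>2 \<in> \<rat>" using d by auto
  then have "(cmod \<gamma>)\<^sup>2 \<in> \<rat>"
    unfolding g by (intro Rats_divide[OF Rats_mult]) simp_all
  moreover have "algebraic_int ((cmod \<gamma>)\<^sup>2)"
  proof -
    have "algebraic_int (\<gamma> * cnj \<gamma>)"
      using \<gamma> N_pos int_adjoin_cnj[OF \<gamma> root_n_power]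
      by (intro int_adjoin_algebraic_int[OF _ root_n_power] int_adjoin_mult) auto
    then show ?thesis
      by (simp add: complex_norm_square[symmetric] flip: of_real_power)
  qed
  ultimately have "(cmod \<gamma>)\<^sup>2 \<in> \<int>" using rational_algebraic_int_is_int by blast
  moreover have "(cmod \<gamma>)\<^sup>2 < 1"
  proof -
    \<comment> \<open>Bounding the squared distance by 4 bounds the norm of \<open>\<gamma>\<close>
      by \<open>2 * N / p\<close>, which is below 1.\<close>
    have "real N ^ 2 * (cmod d)\<^sup>2 \<le> real N ^ 2 * 4"
      using d by (intro mult_left_mono) auto
    also have "\<dots> = (2 * real N) ^ 2" by (simp add: power2_eq_square)
    also have "\<dots> < real p ^ 2"
      using p(2) by (intro power_strict_mono) auto
    finally show ?thesis unfolding g using p by (simp add: divide_less_eq)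
  qed
  moreover obtain m where m: "(cmod \<gamma>)\<^sup>2 = of_int m"
    using calculation(1) by (elim Ints_cases)
  moreover have "m \<ge> 0" using m by (metis of_int_0_le_iff zero_le_power2)
  ultimately have "(cmod \<gamma>)\<^sup>2 = 0" by simp
  then have "d = 0" using norm N_pos by auto
  then show ?thesis by (simp add: d_def)
qed

text \<open>Peeling off one prime factor at a time composes the power maps and, by
  \<open>gal_mult\<close>, the Galois actions.\<close>

lemma coef_pow_large_prime_factors:
  assumes int: "\<And>\<mu>. op_eigenvalue X hs_op \<mu> \<Longrightarrow> \<mu> \<in> \<int>"
    and "k > 0" "\<And>p. prime p \<Longrightarrow> p dvd k \<Longrightarrow> p > 2 * N + 3" "t \<in> X"
  shows "coef (t [^] k) = gal k (coef t)"
  using assms(2-)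
proof (induction k arbitrary: t rule: less_induct)
  case (less k)
  show ?case
  proof (cases "k = 1")
    case True
    then show ?thesis using less.prems by (simp add: gal_def)
  next
    case False
    then obtain p where p: "prime p" "p dvd k" using prime_factor_nat by blast
    then obtain m where m: "k = p * m" by (elim dvdE)
    have "m > 0" "m < k" using m less.prems(1) prime_gt_1_nat[OF p(1)] by auto
    have no3: "\<not> 3 dvd k"
    proof
      assume "3 dvd k"
      then have "3 > 2 * N + 3" using less.prems(2)[of 3] by simp
      then show False by simp
    qed
    have "coef (t [^] k) = coef ((t [^] p) [^] m)"
      using less.prems(3) by (simp add: m nat_pow_pow)
    also have "\<dots> = gal m (coef (t [^] p))"
      using less.prems m \<open>m > 0\<close> \<open>m < k\<close> by (intro less.IH) auto
    also have "coef (t [^] p) = gal p (coef t)"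
      using less.prems p by (intro coef_pow_large_prime int) auto
    also have "gal m (gal p (coef t)) = gal k (coef t)"
      unfolding m using no3 by (subst gal_mult) (auto simp: m)
    finally show ?thesis .
  qed
qed

text \<open>The exponent is replaced by a representative modulo \<open>3 * ord t\<close> all of
  whose prime factors are large. This changes neither the power of \<open>t\<close> nor the residue
  modulo 3, and for residue 1 the Galois action is trivial.\<close>

lemma HS_integral_imp_power_closed:
  assumes int: "\<And>\<mu>. op_eigenvalue X hs_op \<mu> \<Longrightarrow> \<mu> \<in> \<int>"
  shows power_closed
  unfolding power_closed_def
proof (intro ballI allI impI)
  fix t and k :: int
  assume t: "t \<in> S" and k: "coprime k (int (ord t)) \<and> [k = 1] (mod 3)"
  have tX: "t \<in> X" using t sub by blast
  define M where "M = 3 * ord t"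
  have M: "M > 0" using ord_ge_1[OF fin tX] by (simp add: M_def)
  define k0 where "k0 = nat (k mod int M)"
  have k0: "[int k0 = k] (mod int M)" using M by (simp add: k0_def cong_def)
  have "coprime k 3" using cong_imp_coprime[OF cong_sym[of k 1 3]] k by simp
  then have "coprime k (int M)" using k by (simp add: M_def)
  then have "coprime (int k0) (int M)"
    using cong_imp_coprime[OF cong_sym[OF k0]] by simp
  then have "coprime k0 M" by simp
  then obtain k' where k': "[k' = k0] (mod M)" "k' > 0" "\<And>p. prime p \<Longrightarrow> p dvd k' \<Longrightarrow> p > 2 * N + 3"
    using large_prime_lift[of k0 M "2 * N + 3"] M by blast
  have cong: "[int k' = k] (mod int M)"
    using k'(1) k0 by (metis cong_int_iff cong_trans)
  have "[int k' = 1] (mod 3)"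
    using cong_trans[OF cong_dvd_modulus[OF cong, of 3]] k by (simp add: M_def)
  then have "k' mod 3 = 1" by (simp add: cong_def) presburger
  then have "coef (t [^] k') = coef t"
    using coef_pow_large_prime_factors[OF int k'(2,3) tX] by (simp add: gal_def)
  \<comment> \<open>The value \<open>omega6\<close> of the coefficient is attained exactly on
    \<open>S\<close>.\<close>
  then have "t [^] k' \<in> S"
    using t omega6_neq_cnj omega6_neq_0 by (auto simp: coef_def split: if_splits)
  moreover have "t [^] int k' = t [^] k"
    by (rule int_pow_cong[OF tX], rule cong_dvd_modulus[OF cong]) (simp add: M_def)
  ultimately show "t [^] k \<in> S" by (simp add: int_pow_int)
qed

end

theorem theorem3p2:
  fixes G :: "('a, 'b) monoid_scheme" and S :: "'a set"
  assumes "group G"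
    and "finite (carrier G)"
    and "S \<subseteq> carrier G"
    and "\<one>\<^bsub>G\<^esub> \<notin> S"
    and "normal_cayley G S"
    and "oriented_cayley G S"
  shows "HS_integral (cayley_graph G S) \<longleftrightarrow> S \<in> EE G"
proof -
  interpret group G by fact
  interpret skew_normal G S
  proof
    fix g s assume g: "g \<in> carrier G" and "s \<in> S"
    then obtain Y x h where *: "Y \<subseteq> carrier G" "S = (\<Union>x\<in>Y. conjugacy_class G x)"
      "x \<in> Y" "h \<in> carrier G" "s = h \<otimes>\<^bsub>G\<^esub> x \<otimes>\<^bsub>G\<^esub> inv\<^bsub>G\<^esub> h"
      using assms(5) unfolding normal_cayley_def conjugacy_class_def by blast
    have "g \<otimes>\<^bsub>G\<^esub> s \<otimes>\<^bsub>G\<^esub> inv\<^bsub>G\<^esub> g = (g \<otimes>\<^bsub>G\<^esub> h) \<otimes>\<^bsub>G\<^esub> x \<otimes>\<^bsub>G\<^esub> inv\<^bsub>G\<^esub> (g \<otimes>\<^bsub>G\<^esub> h)"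
      using g * by (auto simp: m_assoc inv_mult_group)
    then show "g \<otimes>\<^bsub>G\<^esub> s \<otimes>\<^bsub>G\<^esub> inv\<^bsub>G\<^esub> g \<in> S"
      unfolding *(2) conjugacy_class_def using g * by blast
  next
    show "\<And>s. s \<in> S \<Longrightarrow> inv\<^bsub>G\<^esub> s \<notin> S"
      using assms(6) unfolding oriented_cayley_def skew_symmetric_def by blast
  qed (use assms in auto)
  show ?thesis
    unfolding HS_integral_iff EE_iff
    using power_closed_imp_HS_integral HS_integral_imp_power_closed by blast
qed

end
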